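(* Let $d \geq 1$ be an integer. There exists a constant $m(d)$ (depending only on $d$) such that the following holds. If $k \geq 2d$ is an integer then for any integer $n \geq 2k$, every Boolean degree $d$ function on $\binom{[n]}{k}$ is an $m(d)$-junta. Conversely, if $1 \leq k < 2d$ then for every $m$ there exist $n \geq 2k$ and a Boolean degree $d$ function on $\binom{[n]}{k}$ which is not an $m$-junta.
   Context: For integers $0 \leq k \leq n$, the slice is $\binom{[n]}{k} = \{x \in \{0,1\}^n : \sum_{i=1}^n x_i = k\}$. A function $f\colon \binom{[n]}{k} \to \mathbb{R}$ is Boolean if $f(x) \in \{0,1\}$ for all $x \in \binom{[n]}{k}$. It has degree $d$ (meaning degree at most $d$) if there is a real polynomial $P$ in $n$ variables of degree at most $d$ such that $f(x) = P(x_1,\ldots,x_n)$ for all $x \in \binom{[n]}{k}$. For $J \subseteq [n] = \{1,\ldots,n\}$, $f$ is a $J$-junta if there is a function $g\colon \{0,1\}^J \to \mathbb{R}$ such that $f(x) = g(x|_J)$ for all $x \in \binom{[n]}{k}$, where $x|_J$ is the restriction of $x$ to the coordinates in $J$. $f$ is an $m$-junta if it is a $J$-junta for some $J$ of size at most $m$. *)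

theory Defs
  imports Complex_Main "HOL-Library.FuncSet" "HOL-Library.Poly_Mapping"
begin

text \<open>
  A real polynomial in the variables \<open>x\<^sub>i\<close>, \<open>i :: nat\<close>, is a finitely supported map from monomials
  to coefficients; a monomial is a finitely supported map from variable indices to exponents.
\<close>

type_synonym real_mpoly = "(nat \<Rightarrow>\<^sub>0 nat) \<Rightarrow>\<^sub>0 real"

definition in_vars :: "nat set \<Rightarrow> real_mpoly \<Rightarrow> bool" where
  "in_vars V P \<longleftrightarrow> (\<forall>u\<in>Poly_Mapping.keys P. Poly_Mapping.keys u \<subseteq> V)"

definition total_degree_le :: "nat \<Rightarrow> real_mpoly \<Rightarrow> bool" where
  "total_degree_le d P \<longleftrightarrow>
     (\<forall>u\<in>Poly_Mapping.keys P. (\<Sum>i\<in>Poly_Mapping.keys u. Poly_Mapping.lookup u i) \<le> d)"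

definition mpoly_eval :: "real_mpoly \<Rightarrow> (nat \<Rightarrow> real) \<Rightarrow> real" where
  "mpoly_eval P a = (\<Sum>u\<in>Poly_Mapping.keys P.
     Poly_Mapping.lookup P u * (\<Prod>i\<in>Poly_Mapping.keys u. a i ^ Poly_Mapping.lookup u i))"

definition slice :: "nat \<Rightarrow> nat \<Rightarrow> (nat \<Rightarrow> nat) set" where
  "slice n k = {x \<in> {1..n} \<rightarrow>\<^sub>E {0, 1}. (\<Sum>i=1..n. x i) = k}"

text \<open>
  A function on the slice is represented by a total function of which only the values
  on \<^term>\<open>slice n k\<close> matter.
\<close>

definition boolean_on_slice :: "nat \<Rightarrow> nat \<Rightarrow> ((nat \<Rightarrow> nat) \<Rightarrow> real) \<Rightarrow> bool" where
  "boolean_on_slice n k f \<longleftrightarrow> (\<forall>x\<in>slice n k. f x \<in> {0, 1})"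

definition has_degree :: "nat \<Rightarrow> nat \<Rightarrow> nat \<Rightarrow> ((nat \<Rightarrow> nat) \<Rightarrow> real) \<Rightarrow> bool" where
  "has_degree n k d f \<longleftrightarrow>
     (\<exists>P. in_vars {1..n} P \<and> total_degree_le d P \<and>
          (\<forall>x\<in>slice n k. f x = mpoly_eval P (\<lambda>i. real (x i))))"

definition set_junta :: "nat \<Rightarrow> nat \<Rightarrow> nat set \<Rightarrow> ((nat \<Rightarrow> nat) \<Rightarrow> real) \<Rightarrow> bool" where
  "set_junta n k J f \<longleftrightarrow> (\<exists>g :: (nat \<Rightarrow> nat) \<Rightarrow> real. \<forall>x\<in>slice n k. f x = g (restrict x J))"

definition junta :: "nat \<Rightarrow> nat \<Rightarrow> nat \<Rightarrow> ((nat \<Rightarrow> nat) \<Rightarrow> real) \<Rightarrow> bool" where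
  "junta n k m f \<longleftrightarrow> (\<exists>J \<subseteq> {1..n}. card J \<le> m \<and> set_junta n k J f)"

end

theory Submission
  imports Defs "HOL-Library.Ramsey" "HOL-Library.Infinite_Set"
begin

text \<open>
  A Boolean function on the slice is treated as a \<open>{0, 1}\<close>-valued function \<open>g\<close> of \<open>k\<close>-element
  sets. Of the degree only one consequence is used: if more than \<open>d\<close> pairwise disjoint
  exchanges (one element out, one element in) are available at a set \<open>X\<close>, then the alternating sum
  of \<open>g\<close> over all ways of performing some of them vanishes (\<open>swap_degree_le\<close>), because a
  monomial of degree at most \<open>d\<close> misses the elements of one of the exchanges entirely.
  
  Call a pair \<open>(a, b)\<close> sensitive if exchanging \<open>a\<close> for \<open>b\<close> changes the value of \<open>g\<close> at some set.
  The endpoints of a maximal family of pairwise disjoint sensitive pairs form a set \<open>J\<close> such that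
  \<open>X \<inter> J\<close> determines \<open>g X\<close>, so it suffices to bound the size of such a family in terms of \<open>d\<close>.
  
  The first step reduces the weight to exactly \<open>2 * d\<close> by forcing elements into the sets one
  at a time. Forcing \<open>u\<close> destroys the sensitivity of a given pair for at most \<open>d + 2\<close> choices of
  \<open>u\<close>, so an average choice on a ground set of size \<open>n\<close> keeps a fraction \<open>(n - d - 2) / n\<close> of
  the pairs. As \<open>n \<ge> 2 * k\<close>, these fractions multiply to at least \<open>1 / 2 ^ (d + 2)\<close>.
  
  Now let \<open>k = 2 * d\<close> and suppose that very many disjoint pairs are sensitive. With each pair comes
  a block, a set of \<open>k + 1\<close> elements that witnesses the sensitivity. By Ramsey's theorem a large
  subfamily of blocks is a sunflower on which \<open>g\<close> depends only on the order type of its argument.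
  Elements of remote blocks serve as generic padding, so that \<open>g\<close> yields a function \<open>F\<close> of sets
  of at most \<open>k\<close> elements. Expand \<open>F\<close> into its Moebius coefficients; those of sets with more than
  \<open>d\<close> elements vanish. Let \<open>T\<close> be a set with nonzero coefficient that meets the largest possible
  number \<open>r\<close> of blocks outside the core, and has as few elements as possible given that.
  Put two copies of each of its \<open>r\<close> parts into different blocks, keeping the order; since \<open>T\<close>
  has at most \<open>d\<close> elements and \<open>k \<ge> 2 * d\<close>, all of them fit into one argument of \<open>F\<close>. Consider
  the alternating sum of \<open>F\<close> over the \<open>2 ^ r\<close> ways of keeping or dropping each pair of twins.
  Only coefficients of sets that meet every pair of twins contribute, and by the choice of \<open>T\<close>
  these sets are exactly the \<open>2 ^ r\<close> copies of \<open>T\<close>, all with the same coefficient. So the sum has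
  absolute value at least \<open>2 ^ r\<close>. But \<open>F\<close> has values in \<open>{0, 1}\<close>, so for \<open>r \<ge> 1\<close> the sum has
  absolute value at most \<open>2 ^ (r - 1)\<close>. Hence \<open>r = 0\<close>, and no pair was sensitive after all
  (\<open>coef_eq_0_if_noncore\<close>).
  
  Conversely, if \<open>k < 2 * d\<close>, take many disjoint blocks of size \<open>min d k\<close> and the sum of the
  corresponding monomials: no set of size \<open>k\<close> contains two of the blocks, so this is Boolean, and a
  small set of coordinates misses one of the blocks.
\<close>

section \<open>Alternating sums and the degree of a set function\<close>

text \<open>
  The terms for \<open>U\<close> and for \<open>U\<close> with \<open>a\<close> toggled cancel.
\<close>

lemma alternating_sum_eq_0_if_toggle_invariant:
  fixes f :: "'a set \<Rightarrow> 'b::comm_ring_1"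
  assumes "finite A" "a \<in> A" "\<And>U. U \<subseteq> A - {a} \<Longrightarrow> f (insert a U) = f U"
  shows "(\<Sum>U\<in>Pow A. (-1) ^ card U * f U) = 0"
proof -
  let ?B = "A - {a}"
  have "Pow A = Pow ?B \<union> insert a ` Pow ?B" using Pow_insert[of a ?B] assms(2) by (simp add: insert_absorb)
  moreover have "Pow ?B \<inter> insert a ` Pow ?B = {}" by auto
  ultimately have "(\<Sum>U\<in>Pow A. (-1) ^ card U * f U)
      = (\<Sum>U\<in>Pow ?B. (-1) ^ card U * f U) + (\<Sum>U\<in>insert a ` Pow ?B. (-1) ^ card U * f U)"
    using assms(1) by (simp add: sum.union_disjoint)
  also have "(\<Sum>U\<in>insert a ` Pow ?B. (-1) ^ card U * f U)
      = (\<Sum>U\<in>Pow ?B. (-1) ^ card (insert a U) * f (insert a U))"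
    by (subst sum.reindex) (auto simp: inj_on_def)
  also have "\<dots> = (\<Sum>U\<in>Pow ?B. - ((-1) ^ card U * f U))"
  proof (intro sum.cong refl)
    fix U assume U: "U \<in> Pow ?B"
    then have "finite U" "a \<notin> U" using assms(1) finite_subset by auto
    then show "(-1) ^ card (insert a U) * f (insert a U) = - ((-1) ^ card U * f U)"
      using U assms(3)[of U] by simp
  qed
  finally show ?thesis by (simp add: sum_negf)
qed

text \<open>
  The elements of \<open>A\<close> enter and their partners under \<open>w\<close> leave. The sum is a mixed difference of
  order \<open>card A\<close>, which annihilates polynomials of smaller degree. Stating the degree this way
  makes it stable under fixing coordinates and under renaming the ground set.
\<close>

definition swap_degree_le :: "'a set \<Rightarrow> nat \<Rightarrow> nat \<Rightarrow> ('a set \<Rightarrow> int) \<Rightarrow> bool" where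
  "swap_degree_le V k d g \<longleftrightarrow>
     (\<forall>X A w. X \<subseteq> V \<and> card X = k \<and> A \<subseteq> V - X \<and> d < card A \<and> inj_on w A \<and> w ` A \<subseteq> X \<longrightarrow>
        (\<Sum>U\<in>Pow A. (-1) ^ card U * g (X - w ` U \<union> U)) = 0)"

lemma swap_degree_leD:
  assumes "swap_degree_le V k d g" "X \<subseteq> V" "card X = k" "A \<subseteq> V - X" "d < card A"
    "inj_on w A" "w ` A \<subseteq> X"
  shows "(\<Sum>U\<in>Pow A. (-1) ^ card U * g (X - w ` U \<union> U)) = 0"
  using assms unfolding swap_degree_le_def by blast

lemma card_swap_set:
  assumes "finite X" "finite U" "U \<inter> X = {}" "inj_on w U" "w ` U \<subseteq> X"
  shows "card (X - w ` U \<union> U) = card X"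
proof -
  have "card (X - w ` U \<union> U) = card (X - w ` U) + card U"
    by (rule card_Un_disjoint) (use assms in auto)
  also have "\<dots> = card X - card U + card U"
    using assms by (simp add: card_Diff_subset card_image)
  also have "\<dots> = card X"
    using assms card_mono[of X "w ` U"] by (simp add: card_image)
  finally show ?thesis .
qed

section \<open>Sensitive pairs\<close>

definition sensitive :: "'a set \<Rightarrow> nat \<Rightarrow> ('a set \<Rightarrow> int) \<Rightarrow> 'a \<times> 'a \<Rightarrow> bool" where
  "sensitive V k g p \<longleftrightarrow> (case p of (a, b) \<Rightarrow> a \<in> V \<and> b \<in> V \<and> a \<noteq> b \<and>
     (\<exists>X \<subseteq> V. card X = k \<and> a \<in> X \<and> b \<notin> X \<and> g (insert b (X - {a})) \<noteq> g X))"

definition disjoint_pairs :: "('a \<times> 'a) set \<Rightarrow> bool" where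
  "disjoint_pairs P \<longleftrightarrow>
     (\<forall>p\<in>P. \<forall>q\<in>P. p \<noteq> q \<longrightarrow> {fst p, snd p} \<inter> {fst q, snd q} = {})"

text \<open>
  Forcing \<open>u\<close> to belong to the sets does not raise the degree, as the exchanges leave \<open>u\<close> alone.
\<close>

lemma swap_degree_le_link:
  assumes deg: "swap_degree_le V (Suc k) d g" and "finite V" "u \<in> V"
  shows "swap_degree_le (V - {u}) k d (\<lambda>X. g (insert u X))"
  unfolding swap_degree_le_def
proof (intro allI impI, elim conjE)
  fix X A w
  assume X: "X \<subseteq> V - {u}" "card X = k" and A: "A \<subseteq> V - {u} - X" "d < card A"
    and w: "inj_on w A" "w ` A \<subseteq> X"
  have finX: "finite X" using X assms finite_subset by blast
  have "(\<Sum>U\<in>Pow A. (-1) ^ card U * g (insert u (X - w ` U \<union> U)))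
      = (\<Sum>U\<in>Pow A. (-1) ^ card U * g (insert u X - w ` U \<union> U))"
  proof (intro sum.cong refl)
    fix U assume "U \<in> Pow A"
    then have "insert u (X - w ` U \<union> U) = insert u X - w ` U \<union> U" using w X by blast
    then show "(-1) ^ card U * g (insert u (X - w ` U \<union> U))
             = (-1) ^ card U * g (insert u X - w ` U \<union> U)" by simp
  qed
  also have "\<dots> = 0"
    by (rule swap_degree_leD[OF deg]) (use X A w finX assms in \<open>auto simp: card_insert_if\<close>)
  finally show "(\<Sum>U\<in>Pow A. (-1) ^ card U * g (insert u (X - w ` U \<union> U))) = 0" .
qed

text \<open>
  Let \<open>X\<close> witness the sensitivity of \<open>(a, b)\<close>, and suppose that \<open>d + 1\<close> elements other than
  \<open>a\<close> and \<open>b\<close> destroy it when they are forced. Exchange them for elements of \<open>X\<close>, and compare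
  the alternating sums at \<open>X\<close> and at \<open>X\<close> with \<open>a\<close> replaced by \<open>b\<close>. The terms in which at least
  one of these elements has entered agree, hence so do the remaining ones, which are the values of
  \<open>g\<close> at the two sets. The bound \<open>d + 2\<close> also counts \<open>a\<close> and \<open>b\<close>.
\<close>

lemma card_insensitive_links_le:
  assumes deg: "swap_degree_le V (Suc k) d g" and fin: "finite V" and dk: "d < k"
    and sens: "sensitive V (Suc k) g p"
  shows "card {u \<in> V. \<not> sensitive (V - {u}) k (\<lambda>X. g (insert u X)) p} \<le> d + 2"
proof -
  obtain a b where p: "p = (a, b)" by (cases p)
  obtain X where X: "X \<subseteq> V" "card X = Suc k" "a \<in> X" "b \<notin> X" "g (insert b (X - {a})) \<noteq> g X"
    and ab: "a \<in> V" "b \<in> V" "a \<noteq> b"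
    using sens unfolding sensitive_def p by auto
  have finX: "finite X" using X fin finite_subset by blast
  define B where "B = {u \<in> V - {a, b}. \<not> sensitive (V - {u}) k (\<lambda>X. g (insert u X)) p}"
  have finB: "finite B" unfolding B_def using fin by auto
  (* A bad element cannot lie in any set at which exchanging a for b matters. *)
  have swap: "g (insert b (Y - {a})) = g Y"
    if "u \<in> B" "u \<in> Y" "Y \<subseteq> V" "card Y = Suc k" "a \<in> Y" "b \<notin> Y" for u Y
  proof -
    have u: "u \<noteq> a" "u \<noteq> b" "u \<in> V" using that unfolding B_def by auto
    have finY: "finite Y" using that fin finite_subset by blast
    have "card (Y - {u}) = k" using that finY by simp
    moreover have "g (insert u (insert b (Z - {a}))) = g (insert u Z)"
      if "Z \<subseteq> V - {u}" "card Z = k" "a \<in> Z" "b \<notin> Z" for Z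
      using that \<open>u \<in> B\<close> u ab unfolding B_def sensitive_def p by auto
    ultimately have "g (insert u (insert b (Y - {u} - {a}))) = g (insert u (Y - {u}))"
      using that u by (metis Diff_iff Diff_mono order_refl singletonD)
    moreover have "insert u (insert b (Y - {u} - {a})) = insert b (Y - {a})"
      using that u by auto
    moreover have "insert u (Y - {u}) = Y" using that by auto
    ultimately show ?thesis by simp
  qed
  have BX: "B \<inter> X = {}"
  proof (rule ccontr)
    assume "B \<inter> X \<noteq> {}"
    then obtain u where "u \<in> B" "u \<in> X" by auto
    then show False using swap[of u X] X by simp
  qed
  have "card B \<le> d"
  proof (rule ccontr)
    assume "\<not> card B \<le> d"
    then obtain A where A: "A \<subseteq> B" "card A = Suc d" "finite A"
      by (meson not_less_eq_eq obtain_subset_with_card_n)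
    have "card A \<le> card (X - {a})" using A X dk finX by simp
    then obtain w where w: "w ` A \<subseteq> X - {a}" "inj_on w A"
      using card_le_inj[of A "X - {a}"] A finX by auto
    let ?X' = "insert b (X - {a})"
    have AV: "A \<subseteq> V - X" "b \<notin> A" "a \<notin> A" using A BX unfolding B_def by auto
    have cX': "card ?X' = Suc k" using X finX by (simp add: card_insert_if)
    have "(\<Sum>U\<in>Pow A. (-1) ^ card U * g (X - w ` U \<union> U)) = 0"
      by (rule swap_degree_leD[OF deg]) (use X AV A w in auto)
    moreover have "(\<Sum>U\<in>Pow A. (-1) ^ card U * g (?X' - w ` U \<union> U)) = 0"
      by (rule swap_degree_leD[OF deg]) (use X AV A w cX' ab in auto)
    ultimately have "(\<Sum>U\<in>Pow A. (-1) ^ card U * (g (?X' - w ` U \<union> U) - g (X - w ` U \<union> U))) = 0"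
      by (simp add: right_diff_distrib sum_subtractf)
    moreover have "(\<Sum>U\<in>Pow A. (-1) ^ card U * (g (?X' - w ` U \<union> U) - g (X - w ` U \<union> U)))
        = (\<Sum>U\<in>{{}}. (-1) ^ card U * (g (?X' - w ` U \<union> U) - g (X - w ` U \<union> U)))"
    proof (rule sum.mono_neutral_right)
      show "finite (Pow A)" using A by simp
      show "\<forall>U\<in>Pow A - {{}}. (-1) ^ card U * (g (?X' - w ` U \<union> U) - g (X - w ` U \<union> U)) = 0"
      proof
        fix U assume U: "U \<in> Pow A - {{}}"
        then obtain u where u: "u \<in> U" by auto
        let ?Y = "X - w ` U \<union> U"
        have UA: "U \<subseteq> A" using U by auto
        have "U \<inter> X = {}" "w ` U \<subseteq> X" using UA AV w by auto
        then have "card ?Y = Suc k"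
          using card_swap_set[OF finX finite_subset[OF UA A(3)] _ inj_on_subset[OF w(2) UA]] X(2)
          by simp
        moreover have "u \<in> B" "?Y \<subseteq> V" "a \<in> ?Y" "b \<notin> ?Y" using u UA A w X AV by auto
        ultimately have "g (insert b (?Y - {a})) = g ?Y" using swap[of u ?Y] u by blast
        moreover have "a \<notin> U" "b \<notin> w ` U" using UA AV w X by blast+
        then have "insert b (?Y - {a}) = ?X' - w ` U \<union> U" by blast
        ultimately show "(-1) ^ card U * (g (?X' - w ` U \<union> U) - g (X - w ` U \<union> U)) = 0" by simp
      qed
    qed auto
    ultimately show False using X by simp
  qed
  moreover have "{u \<in> V. \<not> sensitive (V - {u}) k (\<lambda>X. g (insert u X)) p} \<subseteq> B \<union> {a, b}"
    unfolding B_def by auto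
  ultimately have "card {u \<in> V. \<not> sensitive (V - {u}) k (\<lambda>X. g (insert u X)) p} \<le> card (B \<union> {a, b})"
    using finB by (intro card_mono) auto
  also have "\<dots> \<le> card B + card {a, b}" by (rule card_Un_le)
  also have "\<dots> \<le> d + 2" using \<open>card B \<le> d\<close> ab by auto
  finally show ?thesis .
qed

text \<open>
  Count the pairs \<open>(u, p)\<close> for which \<open>p\<close> stays sensitive when \<open>u\<close> is forced, and choose the best
  \<open>u\<close>.
\<close>

lemma exists_link_preserving_sensitivity:
  assumes deg: "swap_degree_le V (Suc k) d g" and fin: "finite V" and dk: "d < k"
    and ne: "V \<noteq> {}"
    and P: "finite P" "\<forall>p\<in>P. sensitive V (Suc k) g p"
  shows "\<exists>u\<in>V. (card V - (d + 2)) * card P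
           \<le> card V * card {p \<in> P. sensitive (V - {u}) k (\<lambda>X. g (insert u X)) p}"
proof (rule ccontr)
  let ?s = "\<lambda>u p. sensitive (V - {u}) k (\<lambda>X. g (insert u X)) p"
  assume "\<not> ?thesis"
  then have less: "card V * card {p \<in> P. ?s u p} < (card V - (d + 2)) * card P" if "u \<in> V" for u
    using that by force
  have "card V * (\<Sum>u\<in>V. card {p \<in> P. ?s u p}) < card V * ((card V - (d + 2)) * card P)"
  proof -
    have "(\<Sum>u\<in>V. card V * card {p \<in> P. ?s u p}) < (\<Sum>u\<in>V. (card V - (d + 2)) * card P)"
      using fin ne less by (intro sum_strict_mono) auto
    then show ?thesis by (simp add: sum_distrib_left)
  qed
  moreover have "(\<Sum>u\<in>V. card {p \<in> P. ?s u p}) = (\<Sum>p\<in>P. card {u \<in> V. ?s u p})"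
    using fin P sum.swap_restrict[of V P "\<lambda>_ _. 1::nat" "\<lambda>u p. ?s u p"] by simp
  moreover have "(\<Sum>p\<in>P. card V - (d + 2)) \<le> (\<Sum>p\<in>P. card {u \<in> V. ?s u p})"
  proof (rule sum_mono)
    fix p assume "p \<in> P"
    then have "card {u \<in> V. \<not> ?s u p} \<le> d + 2"
      using card_insensitive_links_le[OF deg fin dk] P by blast
    moreover have "card V = card {u \<in> V. ?s u p} + card {u \<in> V. \<not> ?s u p}"
      using fin by (subst card_Un_disjoint[symmetric]) (auto intro: arg_cong[where f=card])
    ultimately show "card V - (d + 2) \<le> card {u \<in> V. ?s u p}" by linarith
  qed
  moreover have "card V > 0" using fin ne by auto
  ultimately show False by (simp add: mult.commute)
qed

text \<open>
  One step turns \<open>card P\<close> and \<open>n = card V\<close> into at least \<open>card P * (n - D) / n\<close> and \<open>n - 1\<close>,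
  where \<open>D = d + 2\<close>. As \<open>(n - D) / n\<close> is the ratio of \<open>n - 1 choose D\<close> and \<open>n choose D\<close>, the
  quotient of the number of pairs by \<open>n choose D\<close> never decreases. The lower bound on \<open>card V\<close>
  keeps these binomial coefficients positive; it may fail for \<open>k = 2 * d\<close>, where no step is made.
\<close>

lemma restrict_to_small_slice:
  assumes "swap_degree_le V (K + m) d g" "finite V" "d < K" "m = 0 \<or> K + m + d + 2 \<le> card V"
    "finite P" "\<forall>p\<in>P. sensitive V (K + m) g p" "range g \<subseteq> {0, 1}"
  shows "\<exists>V' g' P'. finite V' \<and> P' \<subseteq> P \<and> range g' \<subseteq> {0, 1} \<and> swap_degree_le V' K d g'
           \<and> (\<forall>p\<in>P'. sensitive V' K g' p)
           \<and> card P * ((card V - m) choose (d + 2)) \<le> card P' * (card V choose (d + 2))"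
  using assms
proof (induction m arbitrary: V g P)
  case 0
  then show ?case by (intro exI[of _ V] exI[of _ g] exI[of _ P]) auto
next
  case (Suc m)
  define n where "n = card V"
  define D where "D = d + 2"
  have n: "n \<ge> K + m + D + 1" using Suc.prems unfolding n_def D_def by simp
  obtain u where u: "u \<in> V" and cnt: "(n - D) * card P
       \<le> n * card {p \<in> P. sensitive (V - {u}) (K + m) (\<lambda>X. g (insert u X)) p}"
    using exists_link_preserving_sensitivity[of V "K + m" d g P] Suc.prems
    unfolding n_def D_def by fastforce
  define Q where "Q = {p \<in> P. sensitive (V - {u}) (K + m) (\<lambda>X. g (insert u X)) p}"
  have cardVu: "card (V - {u}) = n - 1" using u Suc.prems unfolding n_def by simp
  have "\<exists>V' g' P'. finite V' \<and> P' \<subseteq> Q \<and> range g' \<subseteq> {0, 1} \<and> swap_degree_le V' K d g'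
           \<and> (\<forall>p\<in>P'. sensitive V' K g' p)
           \<and> card Q * ((card (V - {u}) - m) choose (d + 2)) \<le> card P' * (card (V - {u}) choose (d + 2))"
  proof (rule Suc.IH)
    show "swap_degree_le (V - {u}) (K + m) d (\<lambda>X. g (insert u X))"
      using swap_degree_le_link[of V "K + m" d g u] Suc.prems u by simp
    show "m = 0 \<or> K + m + d + 2 \<le> card (V - {u})"
      using n cardVu unfolding D_def by linarith
  qed (use Suc.prems in \<open>auto simp: Q_def\<close>)
  then obtain V' g' P' where *: "finite V'" "P' \<subseteq> Q" "range g' \<subseteq> {0, 1}" "swap_degree_le V' K d g'"
     "\<forall>p\<in>P'. sensitive V' K g' p"
     "card Q * ((n - 1 - m) choose D) \<le> card P' * ((n - 1) choose D)"
    unfolding cardVu D_def[symmetric] by blast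
  have "n * ((n - 1) choose D) * (card P * ((n - 1 - m) choose D))
      = (n choose D) * ((n - D) * card P) * ((n - 1 - m) choose D)"
    using binomial_absorb_comp[of n D] by (metis mult.assoc mult.commute)
  also have "\<dots> \<le> (n choose D) * (n * card Q) * ((n - 1 - m) choose D)"
    using cnt unfolding Q_def by (intro mult_right_mono mult_left_mono) auto
  also have "\<dots> = (n choose D) * n * (card Q * ((n - 1 - m) choose D))" by (simp add: mult_ac)
  also have "\<dots> \<le> (n choose D) * n * (card P' * ((n - 1) choose D))"
    using * by (intro mult_left_mono) auto
  also have "\<dots> = n * ((n - 1) choose D) * (card P' * (n choose D))" by (simp add: mult_ac)
  finally have "card P * ((n - 1 - m) choose D) \<le> card P' * (n choose D)"
    using n by (simp add: D_def)
  then show ?case using * unfolding Q_def n_def D_def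
    by (intro exI[of _ V'] exI[of _ g'] exI[of _ P']) auto
qed

lemma binomial_le_two_power_mult:
  assumes "n + D \<le> 2 * s" "s \<le> n"
  shows "n choose D \<le> 2 ^ D * (s choose D)"
proof -
  have "D \<le> s" using assms by simp
  have "real (n choose D) = (\<Prod>i = 0..<D. real (n - i) / real (D - i))"
    using binomial_altdef_of_nat[of D n, where 'a = real] \<open>D \<le> s\<close> assms by simp
  also have "\<dots> \<le> (\<Prod>i = 0..<D. 2 * (real (s - i) / real (D - i)))"
  proof (rule prod_mono, intro conjI)
    fix i assume "i \<in> {0..<D}"
    then have "real (n - i) \<le> 2 * real (s - i)" using assms \<open>D \<le> s\<close> by simp
    then show "real (n - i) / real (D - i) \<le> 2 * (real (s - i) / real (D - i))"
      by (simp add: divide_right_mono)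
  qed simp
  also have "\<dots> = 2 ^ D * (\<Prod>i = 0..<D. real (s - i) / real (D - i))"
    by (simp only: prod.distrib prod_constant card_atLeastLessThan minus_nat.diff_0)
  also have "\<dots> = 2 ^ D * real (s choose D)"
    using binomial_altdef_of_nat[of D s, where 'a = real] \<open>D \<le> s\<close> by simp
  finally have "real (n choose D) \<le> real (2 ^ D * (s choose D))" by simp
  then show ?thesis using of_nat_le_iff by blast
qed

text \<open>
  Two sets of the same size that agree on \<open>J\<close> are connected by exchanges outside \<open>J\<close>.
\<close>

lemma eq_if_insensitive_outside:
  assumes fin: "finite V"
    and ins: "\<And>a b. a \<in> V - J \<Longrightarrow> b \<in> V - J \<Longrightarrow> \<not> sensitive V k g (a, b)"
    and "X \<subseteq> V" "card X = k" "Y \<subseteq> V" "card Y = k" "X \<inter> J = Y \<inter> J"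
  shows "g X = g Y"
  using assms(3-)
proof (induction "card (X - Y)" arbitrary: X)
  case 0
  have "finite X" "finite Y" using 0 fin finite_subset by blast+
  then have "X \<subseteq> Y" using 0 by simp
  then have "X = Y" using 0 \<open>finite Y\<close> by (metis card_subset_eq)
  then show ?case by simp
next
  case (Suc m)
  have finXY: "finite X" "finite Y" using Suc.prems fin finite_subset by blast+
  obtain a where a: "a \<in> X - Y" using Suc.hyps by (metis card.empty ex_in_conv nat.distinct(1))
  have "card (Y - X) = card (X - Y)"
    using finXY Suc.prems by (simp add: card_Diff_subset_Int Int_commute)
  then obtain b where b: "b \<in> Y - X" using Suc.hyps by (metis card.empty ex_in_conv nat.distinct(1))
  let ?X = "insert b (X - {a})"
  have "?X - Y = X - Y - {a}" using a b by auto
  then have "m = card (?X - Y)" using Suc.hyps a finXY by simp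
  moreover have "card ?X = k" using Suc.prems a b finXY card_swap_set[of X "{b}" "\<lambda>_. a"] by simp
  moreover have "?X \<inter> J = Y \<inter> J" "?X \<subseteq> V" using Suc.prems a b by auto
  ultimately have "g ?X = g Y" using Suc.hyps(1)[of ?X] Suc.prems by blast
  moreover have "\<not> sensitive V k g (a, b)" using ins a b Suc.prems by blast
  then have "g ?X = g X" using a b Suc.prems unfolding sensitive_def by auto
  ultimately show ?case by simp
qed

text \<open>
  A family of at most \<open>M\<close> pairs has at most \<open>2 * M\<close> endpoints. These do not determine \<open>g\<close>, so a
  further sensitive pair exists away from them.
\<close>

lemma junta_or_disjoint_sensitive_pairs:
  assumes fin: "finite V"
    and nj: "\<And>J. J \<subseteq> V \<Longrightarrow> card J \<le> 2 * M \<Longrightarrow>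
      \<exists>X Y. X \<subseteq> V \<and> card X = k \<and> Y \<subseteq> V \<and> card Y = k \<and> X \<inter> J = Y \<inter> J \<and> g X \<noteq> g Y"
    and "j \<le> Suc M"
  shows "\<exists>P. finite P \<and> card P = j \<and> disjoint_pairs P \<and> (\<forall>p\<in>P. sensitive V k g p)"
  using \<open>j \<le> Suc M\<close>
proof (induction j)
  case 0
  then show ?case by (intro exI[of _ "{}"]) (auto simp: disjoint_pairs_def)
next
  case (Suc j)
  then obtain P where P: "finite P" "card P = j" "disjoint_pairs P" "\<forall>p\<in>P. sensitive V k g p" by auto
  define J where "J = fst ` P \<union> snd ` P"
  have "card J \<le> card (fst ` P) + card (snd ` P)" unfolding J_def by (rule card_Un_le)
  also have "\<dots> \<le> 2 * j" using P card_image_le[of P fst] card_image_le[of P snd] by simp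
  finally have "card J \<le> 2 * M" using Suc.prems by simp
  moreover have "J \<subseteq> V" using P unfolding J_def sensitive_def by force
  ultimately obtain X Y where XY: "X \<subseteq> V" "card X = k" "Y \<subseteq> V" "card Y = k" "X \<inter> J = Y \<inter> J"
      "g X \<noteq> g Y"
    using nj[of J] by auto
  obtain a b where ab: "a \<in> V - J" "b \<in> V - J" "sensitive V k g (a, b)"
    using eq_if_insensitive_outside[OF fin _ XY(1-5), of g] XY(6) by blast
  have new: "(a, b) \<notin> P" using ab unfolding J_def by force
  have "disjoint_pairs (insert (a, b) P)"
    unfolding disjoint_pairs_def
  proof (intro ballI impI)
    fix p q assume *: "p \<in> insert (a, b) P" "q \<in> insert (a, b) P" "p \<noteq> q"
    have out: "{a, b} \<inter> {fst r, snd r} = {}" if "r \<in> P" for r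
      using ab that unfolding J_def by auto
    consider "p = (a, b)" "q \<in> P" | "q = (a, b)" "p \<in> P" | "p \<in> P" "q \<in> P" using * by blast
    then show "{fst p, snd p} \<inter> {fst q, snd q} = {}"
    proof cases
      case 1
      then show ?thesis using out[of q] by simp
    next
      case 2
      then show ?thesis using out[of p] by (simp add: Int_commute)
    next
      case 3
      then show ?thesis using P(3) * unfolding disjoint_pairs_def by blast
    qed
  qed
  then show ?case using P ab new by (intro exI[of _ "insert (a, b) P"]) auto
qed

section \<open>Order-invariant subfamilies\<close>

lemma sorted_list_of_set_image_strict_mono:
  fixes g :: "nat \<Rightarrow> nat"
  assumes "strict_mono_on B g" "finite B"
  shows "sorted_list_of_set (g ` B) = map g (sorted_list_of_set B)"
proof -
  have "sorted_wrt (\<lambda>x y. g x < g y) (sorted_list_of_set B)"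
    by (rule sorted_wrt_mono_rel[OF _ strict_sorted_list_of_set[of B]])
      (use assms in \<open>auto simp: strict_mono_on_def\<close>)
  then have "sorted_wrt (<) (map g (sorted_list_of_set B))" by (simp add: sorted_wrt_map)
  moreover have "set (map g (sorted_list_of_set B)) = set (sorted_list_of_set (g ` B))"
    using assms by simp
  ultimately show ?thesis
    using strict_sorted_equal[OF strict_sorted_list_of_set[of "g ` B"]] by metis
qed

text \<open>
  Ramsey's theorem in the form used below. A pair \<open>(i, t)\<close> stands for the element with label \<open>t\<close>
  in block \<open>i\<close>. The colour of an \<open>R\<close>-set \<open>K\<close> of indices records all patterns of positions in
  \<open>K\<close> and labels for which the property holds. On a homogeneous set of indices, whether a set of
  such pairs has the property then depends only on its order type. Patterns that use fewer than
  \<open>R\<close> indices are completed by \<open>R\<close> spare indices at the upper end. The Boolean argument of \<open>Q\<close>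
  treats two properties at the same time.
\<close>

lemma order_invariant_subsequence:
  fixes N R L :: nat
  shows "\<exists>M. \<forall>Q :: bool \<Rightarrow> (nat \<times> nat) set \<Rightarrow> bool. \<exists>l.
     strict_mono_on {..<N} l \<and> l ` {..<N} \<subseteq> {..<M} \<and>
     (\<forall>v X \<psi>. X \<subseteq> {..<N} \<times> {..<L} \<and> card (fst ` X) \<le> R \<and>
        strict_mono_on (fst ` X) \<psi> \<and> \<psi> ` fst ` X \<subseteq> {..<N} \<longrightarrow>
        Q v (map_prod l id ` X) = Q v (map_prod (l \<circ> \<psi>) id ` X))"
proof -
  define Cols where "Cols = Pow ((UNIV :: bool set) \<times> Pow ({..<R} \<times> {..<L}))"
  have "finite Cols" unfolding Cols_def by simp
  then obtain h :: "(bool \<times> (nat \<times> nat) set) set \<Rightarrow> nat"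
    where h: "bij_betw h Cols {0..<card Cols}"
    using ex_bij_betw_finite_nat by blast
  obtain M :: nat where M: "partn_lst {..<M} (replicate (card Cols) (N + R)) R"
    using ramsey_full by blast
  show ?thesis
  proof (intro exI[of _ M] allI)
    fix Q :: "bool \<Rightarrow> (nat \<times> nat) set \<Rightarrow> bool"
    define pl :: "nat set \<Rightarrow> (nat \<times> nat) set \<Rightarrow> (nat \<times> nat) set"
      where "pl K W = (\<lambda>(p, t). (sorted_list_of_set K ! p, t)) ` W" for K W
    define col where "col K = {(v, W). W \<subseteq> {..<R} \<times> {..<L} \<and> Q v (pl K W)}" for K
    have colC: "col K \<in> Cols" for K unfolding col_def Cols_def by auto
    have hcol: "h \<circ> col \<in> nsets {..<M} R \<rightarrow> {..<card Cols}"
      using h colC by (auto simp: bij_betw_def)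
    obtain i H where i: "i < length (replicate (card Cols) (N + R))" "H \<in> nsets {..<M} (replicate (card Cols) (N + R) ! i)"
        "(h \<circ> col) ` nsets H R \<subseteq> {i}"
      using partn_lstE[OF M hcol length_replicate] by metis
    have H: "H \<subseteq> {..<M}" "finite H" "card H = N + R"
      using i(1,2) by (simp_all add: nsets_def)
    have Hi: "h (col K) = i" if "K \<in> nsets H R" for K using i(3) that by auto
    have same: "col K = col K'" if "K \<in> nsets H R" "K' \<in> nsets H R" for K K'
      using Hi[OF that(1)] Hi[OF that(2)] colC bij_betw_imp_inj_on[OF h] by (metis inj_onD)
    obtain l where l: "bij_betw l {..<N + R} H" "strict_mono_on {..<N + R} l"
      using ex_bij_betw_strict_mono_card[OF H(2)] H(3) by metis
    have linj: "inj_on l {..<N + R}" using l by (simp add: bij_betw_def)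
    have lH: "l ` {..<N + R} \<subseteq> H" using l by (simp add: bij_betw_def)
    have main: "Q v (map_prod l id ` X) = Q v (map_prod (l \<circ> \<psi>) id ` X)"
      if X: "X \<subseteq> {..<N} \<times> {..<L}" "card (fst ` X) \<le> R"
        and \<psi>: "strict_mono_on (fst ` X) \<psi>" "\<psi> ` fst ` X \<subseteq> {..<N}" for v X \<psi>
    proof -
      (* Complete the indices of X to exactly R of them by spare indices, which phi keeps in place. *)
      define B where "B = fst ` X \<union> {N..<N + (R - card (fst ` X))}"
      define \<phi> where "\<phi> i = (if i < N then \<psi> i else i)" for i
      have fX: "fst ` X \<subseteq> {..<N}" using X by auto
      then have fin: "finite (fst ` X)" using finite_subset by blast
      have BN: "B \<subseteq> {..<N + R}" unfolding B_def using fX by auto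
      have finB: "finite B" unfolding B_def using fin by simp
      have cB: "card B = R"
        unfolding B_def using fX fin X(2) by (subst card_Un_disjoint) auto
      have \<phi>low: "\<phi> i < N" "i \<in> fst ` X" if "i \<in> B" "i < N" for i
        using that \<psi>(2) unfolding B_def \<phi>_def by auto
      have \<phi>high: "\<phi> i = i" "i < N + R" if "i \<in> B" "\<not> i < N" for i
        using that BN unfolding \<phi>_def by auto
      have \<phi>B: "\<phi> ` B \<subseteq> {..<N + R}"
        using \<phi>low(1) \<phi>high by (force simp: image_subset_iff)
      have \<phi>mono: "strict_mono_on B \<phi>"
      proof (rule strict_mono_onI)
        fix r s assume *: "r \<in> B" "s \<in> B" "r < s"
        show "\<phi> r < \<phi> s"
        proof (cases "s < N")
          case True
          then have "r < N" using * by simp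
          then show ?thesis
            using \<phi>low(2)[of r] \<phi>low(2)[of s] strict_mono_onD[OF \<psi>(1)] * True
            unfolding \<phi>_def by simp
        next
          case False
          then show ?thesis using \<phi>low(1)[of r] \<phi>high(1)[of r] \<phi>high(1)[of s] * by fastforce
        qed
      qed
      have lB: "strict_mono_on B l" using l(2) BN unfolding strict_mono_on_def by blast
      have l\<phi>B: "strict_mono_on B (l \<circ> \<phi>)"
        using l(2) \<phi>mono \<phi>B unfolding strict_mono_on_def by (simp add: image_subset_iff)
      have inj: "inj_on l B" "inj_on (l \<circ> \<phi>) B"
        using lB l\<phi>B strict_mono_on_imp_inj_on by blast+
      have K: "l ` B \<in> nsets H R"
        using lH BN cB inj(1) finB by (auto simp: nsets_def card_image)
      have K': "(l \<circ> \<phi>) ` B \<in> nsets H R"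
      proof -
        have "(l \<circ> \<phi>) ` B \<subseteq> H" using \<phi>B lH by (auto simp: image_subset_iff)
        moreover have "card ((l \<circ> \<phi>) ` B) = R" using inj(2) cB by (metis card_image)
        ultimately show ?thesis using finB by (simp add: nsets_def)
      qed
      define bs where "bs = sorted_list_of_set B"
      have len: "length bs = R" unfolding bs_def using cB by simp
      have setbs: "set bs = B" unfolding bs_def using finB by simp
      define W where "W = {(p, t). p < R \<and> (bs ! p, t) \<in> X}"
      have W: "W \<subseteq> {..<R} \<times> {..<L}" unfolding W_def using X by auto
      have bsW: "(\<lambda>(p, t). (bs ! p, t)) ` W = X"
      proof
        show "(\<lambda>(p, t). (bs ! p, t)) ` W \<subseteq> X" unfolding W_def by auto
        show "X \<subseteq> (\<lambda>(p, t). (bs ! p, t)) ` W"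
        proof
          fix x assume x: "x \<in> X"
          then have "fst x \<in> set bs" unfolding setbs B_def by auto
          then obtain p where "p < R" "bs ! p = fst x" using len by (metis in_set_conv_nth)
          then have "(p, snd x) \<in> W" "x = (bs ! p, snd x)" unfolding W_def using x by auto
          then show "x \<in> (\<lambda>(p, t). (bs ! p, t)) ` W" by force
        qed
      qed
      have pl: "pl (f ` B) W = map_prod f id ` X" if "strict_mono_on B f" for f
      proof -
        have "pl (f ` B) W = (\<lambda>(p, t). (map f bs ! p, t)) ` W"
          unfolding pl_def bs_def using sorted_list_of_set_image_strict_mono[OF that finB] by simp
        also have "\<dots> = (\<lambda>(p, t). (f (bs ! p), t)) ` W"
          using W len by (intro image_cong) auto
        also have "\<dots> = map_prod f id ` (\<lambda>(p, t). (bs ! p, t)) ` W"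
          by (force simp: image_image)
        finally show ?thesis unfolding bsW .
      qed
      have "Q v (pl (l ` B) W) = Q v (pl ((l \<circ> \<phi>) ` B) W)"
        using same[OF K K'] W unfolding col_def by blast
      then have "Q v (map_prod l id ` X) = Q v (map_prod (l \<circ> \<phi>) id ` X)"
        using pl[OF lB] pl[OF l\<phi>B] by simp
      also have "map_prod (l \<circ> \<phi>) id ` X = map_prod (l \<circ> \<psi>) id ` X"
        using fX unfolding \<phi>_def by (intro image_cong) (auto simp: map_prod_def)
      finally show ?thesis .
    qed
    show "\<exists>l. strict_mono_on {..<N} l \<and> l ` {..<N} \<subseteq> {..<M} \<and>
       (\<forall>v X \<psi>. X \<subseteq> {..<N} \<times> {..<L} \<and> card (fst ` X) \<le> R \<and>
          strict_mono_on (fst ` X) \<psi> \<and> \<psi> ` fst ` X \<subseteq> {..<N} \<longrightarrow>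
          Q v (map_prod l id ` X) = Q v (map_prod (l \<circ> \<psi>) id ` X))"
    proof (intro exI[of _ l] conjI allI impI; (elim conjE)?)
      show "strict_mono_on {..<N} l" using l(2) unfolding strict_mono_on_def by auto
      show "l ` {..<N} \<subseteq> {..<M}"
        using lH H(1) lessThan_subset_iff[of N "N + R"] by (meson image_mono le_add1 order_trans)
    qed (rule main)
  qed
qed

text \<open>
  The first conjunct says that the blocks form a sunflower and that an element of the core has the
  same label in all blocks. The second one says that \<open>g\<close> depends only on the order type.
\<close>

definition homogeneous_family ::
  "nat \<Rightarrow> nat \<Rightarrow> nat \<Rightarrow> (nat \<Rightarrow> nat \<Rightarrow> 'a) \<Rightarrow> ('a set \<Rightarrow> int) \<Rightarrow> bool" where
  "homogeneous_family N R L e g \<longleftrightarrow>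
     (\<forall>i<N. \<forall>j<N. \<forall>s<L. \<forall>t<L. i \<noteq> j \<and> e i s = e j t \<longrightarrow> s = t \<and> (\<forall>i'<N. e i' s = e 0 s)) \<and>
     (\<forall>X \<psi>. X \<subseteq> {..<N} \<times> {..<L} \<and> card (fst ` X) \<le> R \<and>
        strict_mono_on (fst ` X) \<psi> \<and> \<psi> ` fst ` X \<subseteq> {..<N} \<longrightarrow>
        g ((\<lambda>(i, t). e i t) ` X) = g ((\<lambda>(i, t). e (\<psi> i) t) ` X))"

text \<open>
  Whether two labelled elements coincide is a property of order types as well. If label \<open>s\<close> in
  one block and label \<open>t\<close> in a later block always give the same element, then comparing blocks
  \<open>0\<close>, \<open>1\<close> and \<open>2\<close> yields \<open>s = t\<close>, and the element belongs to all blocks.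
\<close>

lemma ex_homogeneous_subfamily:
  fixes N R L :: nat
  assumes "2 \<le> R" "3 \<le> N"
  shows "\<exists>M. \<forall>(e :: nat \<Rightarrow> nat \<Rightarrow> 'a) (g :: 'a set \<Rightarrow> int).
     range g \<subseteq> {0, 1} \<and> (\<forall>j<M. inj_on (e j) {..<L}) \<longrightarrow>
     (\<exists>l. strict_mono_on {..<N} l \<and> l ` {..<N} \<subseteq> {..<M} \<and> homogeneous_family N R L (e \<circ> l) g)"
proof -
  obtain M where M: "\<forall>Q :: bool \<Rightarrow> (nat \<times> nat) set \<Rightarrow> bool. \<exists>l.
     strict_mono_on {..<N} l \<and> l ` {..<N} \<subseteq> {..<M} \<and>
     (\<forall>v X \<psi>. X \<subseteq> {..<N} \<times> {..<L} \<and> card (fst ` X) \<le> R \<and>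
        strict_mono_on (fst ` X) \<psi> \<and> \<psi> ` fst ` X \<subseteq> {..<N} \<longrightarrow>
        Q v (map_prod l id ` X) = Q v (map_prod (l \<circ> \<psi>) id ` X))"
    using order_invariant_subsequence[of N L R] by blast
  show ?thesis
  proof (intro exI[of _ M] allI impI, elim conjE)
    fix e :: "nat \<Rightarrow> nat \<Rightarrow> 'a" and g :: "'a set \<Rightarrow> int"
    assume g: "range g \<subseteq> {0, 1}" and e: "\<forall>j<M. inj_on (e j) {..<L}"
    define Q where "Q v X = (if v then g ((\<lambda>(i, t). e i t) ` X) = 1 else inj_on (\<lambda>(i, t). e i t) X)"
      for v X
    obtain l where l: "strict_mono_on {..<N} l" "l ` {..<N} \<subseteq> {..<M}"
      and Q: "\<And>v X \<psi>. X \<subseteq> {..<N} \<times> {..<L} \<Longrightarrow> card (fst ` X) \<le> R \<Longrightarrow>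
        strict_mono_on (fst ` X) \<psi> \<Longrightarrow> \<psi> ` fst ` X \<subseteq> {..<N} \<Longrightarrow>
        Q v (map_prod l id ` X) = Q v (map_prod (l \<circ> \<psi>) id ` X)"
      using M[rule_format, of Q] by metis
    have inv: "g ((\<lambda>(i, t). e (l i) t) ` X) = g ((\<lambda>(i, t). e (l (\<psi> i)) t) ` X)"
      if "X \<subseteq> {..<N} \<times> {..<L}" "card (fst ` X) \<le> R"
        "strict_mono_on (fst ` X) \<psi>" "\<psi> ` fst ` X \<subseteq> {..<N}" for X \<psi>
    proof -
      have im: "(\<lambda>(i, t). e i t) ` map_prod f id ` X = (\<lambda>(i, t). e (f i) t) ` X" for f :: "nat \<Rightarrow> nat"
        by (force simp: image_image)
      have "g ((\<lambda>(i, t). e (l i) t) ` X) = 1 \<longleftrightarrow> g ((\<lambda>(i, t). e (l (\<psi> i)) t) ` X) = 1"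
        using Q[OF that, of True] unfolding Q_def im by simp
      moreover have "g Y = 0 \<or> g Y = 1" for Y using g by auto
      ultimately show ?thesis by metis
    qed
    have lne: "l i \<noteq> l j" if "i < j" "j < N" for i j
      using l(1) that unfolding strict_mono_on_def by (metis lessThan_iff less_irrefl order.strict_trans)
    have inj: "e (l i) s = e (l i) t \<longleftrightarrow> s = t" if "i < N" "s < L" "t < L" for i s t
      using e l(2) that by (auto simp: inj_on_def)
    have coin: "e (l i) s = e (l j) t \<longleftrightarrow> e (l i') s = e (l j') t"
      if "i < j" "j < N" "i' < j'" "j' < N" "s < L" "t < L" for i j i' j' s t
    proof -
      define \<psi> where "\<psi> x = (if x = i then i' else j')" for x
      have "Q False (map_prod l id ` {(i, s), (j, t)})
          = Q False (map_prod (l \<circ> \<psi>) id ` {(i, s), (j, t)})"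
      proof (rule Q)
        have "card {i, j} \<le> 2" by (simp add: card_insert_if)
        then show "card (fst ` {(i, s), (j, t)}) \<le> R" using assms by simp
      qed (use that in \<open>auto simp: strict_mono_on_def \<psi>_def\<close>)
      then show ?thesis
        using that lne[of i j] lne[of i' j'] unfolding Q_def \<psi>_def by simp
    qed
    have sun: "s = t \<and> (\<forall>i'<N. e (l i') s = e (l 0) s)"
      if "i < j" "j < N" "s < L" "t < L" "e (l i) s = e (l j) t" for i j s t
    proof -
      have N: "1 < N" "2 < N" using assms by auto
      have "e (l 0) s = e (l 1) t" using coin[of i j 0 1 s t] that N by simp
      moreover have "e (l 0) s = e (l 2) t" using coin[of i j 0 2 s t] that N by simp
      moreover have "e (l 1) s = e (l 2) t" using coin[of i j 1 2 s t] that N by simp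
      ultimately have "e (l 1) s = e (l 1) t" by simp
      then have st: "s = t" using inj N that by blast
      have "e (l i') s = e (l 0) s" if "i' < N" for i'
      proof (cases "i' = 0")
        case False
        then show ?thesis using coin[of i j 0 i' s t] st \<open>i' < N\<close> \<open>i < j\<close> \<open>j < N\<close> \<open>s < L\<close>
            \<open>e (l i) s = e (l j) t\<close> by auto
      qed simp
      then show ?thesis using st by blast
    qed
    have sun2: "s = t \<and> (\<forall>i'<N. e (l i') s = e (l 0) s)"
      if "i < N" "j < N" "s < L" "t < L" "i \<noteq> j" "e (l i) s = e (l j) t" for i j s t
    proof (cases "i < j")
      case True
      then show ?thesis using sun that by blast
    next
      case False
      then have "j < i" using that by simp
      then show ?thesis using sun[of j i t s] that by metis
    qed
    have "homogeneous_family N R L (e \<circ> l) g"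
      unfolding homogeneous_family_def o_def
    proof
      show "\<forall>i<N. \<forall>j<N. \<forall>s<L. \<forall>t<L. i \<noteq> j \<and> e (l i) s = e (l j) t \<longrightarrow>
           s = t \<and> (\<forall>i'<N. e (l i') s = e (l 0) s)"
        using sun2 by blast
    qed (use inv in blast)
    then show "\<exists>l. strict_mono_on {..<N} l \<and> l ` {..<N} \<subseteq> {..<M} \<and>
        homogeneous_family N R L (e \<circ> l) g"
      using l by blast
  qed
qed

section \<open>Order-invariant functions of low degree\<close>

text \<open>
  An element of the sunflower is represented by a unique node: \<open>(0, t)\<close> for an element of the core,
  and \<open>(i, t)\<close> with \<open>i > 0\<close> and \<open>t \<in> Lab\<close> for an element of block \<open>i\<close> outside the core. Indices up
  to \<open>2 * d\<close> leave room for two copies of \<open>d\<close> parts, and the \<open>k\<close> indices above them provide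
  the padding, for which the label \<open>b\<close> is used.
\<close>

locale homogeneous_nodes =
  fixes d k :: nat and Core Lab :: "nat set" and b :: nat and G :: "(nat \<times> nat) set \<Rightarrow> int"
  assumes fin_Core: "finite Core" and fin_Lab: "finite Lab" and b: "b \<in> Lab"
    and dk: "2 * d \<le> k" and boolean: "range G \<subseteq> {0, 1}"
    and degree: "swap_degree_le ({0} \<times> Core \<union> {0<..<2 * d + 1 + k} \<times> Lab) k d G"
    and order_invariant: "\<And>X \<psi>. X \<subseteq> {0} \<times> Core \<union> {0<..<2 * d + 1 + k} \<times> Lab \<Longrightarrow> card X = k \<Longrightarrow>
      strict_mono_on (fst ` X) \<psi> \<Longrightarrow>
      map_prod \<psi> id ` X \<subseteq> {0} \<times> Core \<union> {0<..<2 * d + 1 + k} \<times> Lab \<Longrightarrow>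
      G (map_prod \<psi> id ` X) = G X"
begin

definition Nodes :: "(nat \<times> nat) set" where
  "Nodes = {0} \<times> Core \<union> {0<..<2 * d + 1 + k} \<times> Lab"

definition low :: "(nat \<times> nat) set" where
  "low = {0} \<times> Core \<union> {0<..2 * d} \<times> Lab"

definition pad :: "nat set \<Rightarrow> (nat \<times> nat) set" where
  "pad I = (\<lambda>i. (2 * d + 1 + i, b)) ` I"

text \<open>
  The value of \<open>G\<close> at \<open>U\<close> padded by remote nodes to a set of size \<open>k\<close>.
\<close>

definition F :: "(nat \<times> nat) set \<Rightarrow> int" where
  "F U = G (U \<union> pad {..<k - card U})"

text \<open>
  The Moebius coefficient of \<open>F\<close> at \<open>T\<close>, up to the sign \<open>(-1) ^ card T\<close>. With this
  normalisation the inversion formula is symmetric.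
\<close>

definition coef :: "(nat \<times> nat) set \<Rightarrow> int" where
  "coef T = (\<Sum>U\<in>Pow T. (-1) ^ card U * F U)"

lemma finite_low: "finite low"
  unfolding low_def using fin_Core fin_Lab by simp

lemma low_subset_Nodes: "low \<subseteq> Nodes"
  unfolding low_def Nodes_def by auto

lemma fst_low: "x \<in> low \<Longrightarrow> fst x \<le> 2 * d"
  unfolding low_def by auto

lemma pad_subset_Nodes: "I \<subseteq> {..<k} \<Longrightarrow> pad I \<subseteq> Nodes"
  unfolding pad_def Nodes_def using b by auto

lemma low_Int_pad: "low \<inter> pad I = {}"
  using fst_low by (force simp: pad_def)

lemma card_pad: "card (pad I) = card I"
  unfolding pad_def by (rule card_image) (auto simp: inj_on_def)

lemma F_boolean: "F U = 0 \<or> F U = 1"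
  unfolding F_def using boolean by auto

lemma card_low_Un_pad:
  assumes "U \<subseteq> low" "finite I"
  shows "card (U \<union> pad I) = card U + card I"
proof -
  have "finite U" using assms finite_low finite_subset by blast
  moreover have "finite (pad I)" unfolding pad_def using assms by simp
  moreover have "U \<inter> pad I = {}" using low_Int_pad assms by blast
  ultimately show ?thesis using card_pad by (simp add: card_Un_disjoint)
qed

text \<open>
  All paddings of the same size lie above \<open>U\<close> and hence have the same order type over it.
\<close>

lemma F_eq_any_pad:
  assumes U: "U \<subseteq> low" "card U \<le> k" and I: "I \<subseteq> {..<k}" "card I = k - card U"
  shows "G (U \<union> pad I) = F U"
proof -
  let ?m = "k - card U" and ?n = "2 * d + 1"
  have "finite I" using I finite_subset by blast
  then obtain h where h: "bij_betw h {..<?m} I" "strict_mono_on {..<?m} h"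
    using ex_bij_betw_strict_mono_card I by metis
  have hI: "h ` {..<?m} = I" using h by (simp add: bij_betw_def)
  define \<psi> where "\<psi> i = (if i < ?n then i else ?n + h (i - ?n))" for i
  have 1: "map_prod \<psi> id ` U = U"
  proof -
    have "map_prod \<psi> id x = x" if "x \<in> U" for x
      using fst_low[of x] U that unfolding \<psi>_def by (cases x) auto
    then show ?thesis by simp
  qed
  have 2: "map_prod \<psi> id ` pad {..<?m} = pad I"
    unfolding pad_def hI[symmetric] image_image \<psi>_def by simp
  have im: "map_prod \<psi> id ` (U \<union> pad {..<?m}) = U \<union> pad I"
    by (simp add: image_Un 1 2)
  have "G (map_prod \<psi> id ` (U \<union> pad {..<?m})) = G (U \<union> pad {..<?m})"
  proof (rule order_invariant, fold Nodes_def)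
    show "U \<union> pad {..<?m} \<subseteq> Nodes"
      using U low_subset_Nodes pad_subset_Nodes[of "{..<?m}"] by auto
    show "map_prod \<psi> id ` (U \<union> pad {..<?m}) \<subseteq> Nodes"
      unfolding im using U low_subset_Nodes pad_subset_Nodes[OF I(1)] by auto
    show "card (U \<union> pad {..<?m}) = k" using card_low_Un_pad[OF U(1)] U(2) by simp
    show "strict_mono_on (fst ` (U \<union> pad {..<?m})) \<psi>"
    proof (rule strict_mono_onI)
      fix r s assume r: "r \<in> fst ` (U \<union> pad {..<?m})" and s: "s \<in> fst ` (U \<union> pad {..<?m})"
        and rs: "r < s"
      have high: "i - ?n < ?m" if "i \<in> fst ` (U \<union> pad {..<?m})" "\<not> i < ?n" for i
        using that fst_low U(1) unfolding pad_def by fastforce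
      show "\<psi> r < \<psi> s"
      proof (cases "r < ?n")
        case True
        then show ?thesis using rs unfolding \<psi>_def by auto
      next
        case False
        then have "r - ?n < s - ?n" using rs by simp
        moreover have "r - ?n < ?m" "s - ?n < ?m" using high r s False rs by auto
        ultimately have "h (r - ?n) < h (s - ?n)"
          using strict_mono_onD[OF h(2)] by blast
        then show ?thesis using False rs unfolding \<psi>_def by auto
      qed
    qed
  qed
  then show ?thesis unfolding im F_def .
qed

text \<open>
  Start from a set that consists of padding only, and exchange distinct padding nodes for the
  elements of \<open>T\<close>. As the value of \<open>G\<close> does not depend on which padding remains, the
  alternating sum over these exchanges is the coefficient at \<open>T\<close>.
\<close>

lemma coef_eq_0:
  assumes T: "T \<subseteq> low" "d < card T" "card T \<le> k"
  shows "coef T = 0"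
proof -
  have finT: "finite T" using T finite_low finite_subset by blast
  obtain w where w: "w ` T \<subseteq> {..<k}" "inj_on w T"
    using card_le_inj[of T "{..<k}"] finT T by auto
  define w' where "w' t = (2 * d + 1 + w t, b)" for t
  have "(\<Sum>U\<in>Pow T. (-1) ^ card U * G (pad {..<k} - w' ` U \<union> U)) = 0"
  proof (rule swap_degree_leD[OF degree], fold Nodes_def)
    show "pad {..<k} \<subseteq> Nodes" by (rule pad_subset_Nodes) simp
    show "card (pad {..<k}) = k" by (simp add: card_pad)
    show "T \<subseteq> Nodes - pad {..<k}" using T(1) low_subset_Nodes low_Int_pad by blast
    show "inj_on w' T" using w(2) unfolding w'_def inj_on_def by auto
    show "w' ` T \<subseteq> pad {..<k}" using w(1) unfolding w'_def pad_def by auto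
  qed (use T in auto)
  moreover have "G (pad {..<k} - w' ` U \<union> U) = F U" if "U \<in> Pow T" for U
  proof -
    have U: "U \<subseteq> low" "finite U" "inj_on w U" "w ` U \<subseteq> {..<k}" "card U \<le> k"
      using that T finT w card_mono[of T U] by (auto intro: finite_subset inj_on_subset)
    have "pad {..<k} - w' ` U = pad ({..<k} - w ` U)"
      unfolding pad_def w'_def by auto
    moreover have "card ({..<k} - w ` U) = k - card U"
      using U by (simp add: card_Diff_subset card_image)
    ultimately show ?thesis
      using F_eq_any_pad[OF U(1,5), of "{..<k} - w ` U"] by (simp add: Un_commute)
  qed
  ultimately show ?thesis unfolding coef_def by simp
qed

lemma coef_order_invariant:
  assumes T: "T \<subseteq> low" "card T \<le> k" and \<psi>: "strict_mono_on (fst ` T) \<psi>"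
    and im: "map_prod \<psi> id ` T \<subseteq> low"
  shows "coef (map_prod \<psi> id ` T) = coef T" "card (map_prod \<psi> id ` T) = card T"
proof -
  let ?f = "map_prod \<psi> (id :: nat \<Rightarrow> nat)" and ?n = "2 * d + 1"
  have finT: "finite T" using T finite_low finite_subset by blast
  have "inj_on \<psi> (fst ` T)" using \<psi> strict_mono_on_imp_inj_on by blast
  then have inj: "inj_on ?f T" by (force simp: inj_on_def)
  show "card (?f ` T) = card T" using inj by (rule card_image)
  have F: "F (?f ` U) = F U" if "U \<in> Pow T" for U
  proof -
    have U: "U \<subseteq> low" "card U \<le> k" "U \<subseteq> T"
      using that T finT card_mono[of T U] by auto
    have cU: "card (?f ` U) = card U" using inj U(3) by (meson card_image inj_on_subset)
    define \<chi> where "\<chi> i = (if i < ?n then \<psi> i else i)" for i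
    have 1: "map_prod \<chi> id ` U = ?f ` U"
    proof (rule image_cong)
      fix x assume "x \<in> U"
      then show "map_prod \<chi> id x = ?f x"
        using fst_low[of x] U(1) unfolding \<chi>_def by (cases x) auto
    qed simp
    have 2: "map_prod \<chi> id ` pad {..<k - card U} = pad {..<k - card U}"
      unfolding pad_def image_image \<chi>_def by simp
    have im': "map_prod \<chi> id ` (U \<union> pad {..<k - card U}) = ?f ` U \<union> pad {..<k - card U}"
      by (simp add: image_Un 1 2)
    have "G (map_prod \<chi> id ` (U \<union> pad {..<k - card U})) = G (U \<union> pad {..<k - card U})"
    proof (rule order_invariant, fold Nodes_def)
      show "U \<union> pad {..<k - card U} \<subseteq> Nodes"
        using U low_subset_Nodes pad_subset_Nodes[of "{..<k - card U}"] by auto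
      show "map_prod \<chi> id ` (U \<union> pad {..<k - card U}) \<subseteq> Nodes"
        unfolding im' using U im low_subset_Nodes pad_subset_Nodes[of "{..<k - card U}"] by auto
      show "card (U \<union> pad {..<k - card U}) = k" using card_low_Un_pad[OF U(1)] U(2) by simp
      show "strict_mono_on (fst ` (U \<union> pad {..<k - card U})) \<chi>"
      proof (rule strict_mono_onI)
        fix r s assume r: "r \<in> fst ` (U \<union> pad {..<k - card U})"
          and s: "s \<in> fst ` (U \<union> pad {..<k - card U})" and rs: "r < s"
        have lowT: "i \<in> fst ` T" "\<psi> i < ?n"
          if "i \<in> fst ` (U \<union> pad {..<k - card U})" "i < ?n" for i
        proof -
          show "i \<in> fst ` T" using that U(3) unfolding pad_def by auto
          then obtain t where "(i, t) \<in> T" by auto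
          then have "(\<psi> i, t) \<in> low" using im by force
          then show "\<psi> i < ?n" using fst_low by force
        qed
        show "\<chi> r < \<chi> s"
        proof (cases "s < ?n")
          case True
          then show ?thesis
            using lowT(1)[OF r] lowT(1)[OF s] rs strict_mono_onD[OF \<psi>] unfolding \<chi>_def by simp
        next
          case False
          then show ?thesis using lowT(2)[OF r] rs unfolding \<chi>_def by auto
        qed
      qed
    qed
    then show ?thesis unfolding im' F_def cU .
  qed
  have "coef (?f ` T) = (\<Sum>U\<in>image ?f ` Pow T. (-1) ^ card U * F U)"
    unfolding coef_def by (simp add: image_Pow_surj[OF refl])
  also have "\<dots> = (\<Sum>U\<in>Pow T. (-1) ^ card (?f ` U) * F (?f ` U))"
    using inj_on_image_Pow[OF inj] by (simp add: sum.reindex)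
  also have "\<dots> = coef T"
    unfolding coef_def
  proof (intro sum.cong refl)
    fix U assume U: "U \<in> Pow T"
    then have "card (?f ` U) = card U" using inj by (meson PowD card_image inj_on_subset)
    then show "(-1) ^ card (?f ` U) * F (?f ` U) = (-1) ^ card U * F U" using F[OF U] by simp
  qed
  finally show "coef (?f ` T) = coef T" .
qed

lemma F_eq_sum_coef:
  assumes "finite U"
  shows "F U = (\<Sum>T\<in>Pow U. (-1) ^ card T * coef T)"
  by (rule inclusion_exclusion_symmetric) (use assms in \<open>simp_all add: coef_def\<close>)

text \<open>
  The doubling argument: \<open>r\<close> is the maximal number of noncore blocks that a set with nonzero
  coefficient meets, and each of the \<open>r\<close> parts of an optimal set \<open>T\<close> is placed into two blocks.
  The maximality of \<open>r\<close> and the minimality of \<open>T\<close> ensure that an alternating sum of \<open>2 ^ r\<close>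
  values in \<open>{0, 1}\<close> collects nothing but \<open>2 ^ r\<close> equal nonzero integers.
\<close>

lemma coef_eq_0_if_noncore:
  assumes T0: "T0 \<subseteq> low" "card T0 \<le> k" "\<not> fst ` T0 \<subseteq> {0}"
  shows "coef T0 = 0"
proof (rule ccontr)
  assume c0: "coef T0 \<noteq> 0"
  define idx where "idx T = fst ` T - {0 :: nat}" for T :: "(nat \<times> nat) set"
  define cand where "cand = {T. T \<subseteq> low \<and> card T \<le> k \<and> coef T \<noteq> 0}"
  have fin_cand: "finite cand" unfolding cand_def using finite_low by simp
  have fin_idx: "finite (idx T)" if "T \<subseteq> low" for T
    unfolding idx_def using that finite_low finite_subset by blast
  define r where "r = Max ((\<lambda>T. card (idx T)) ` cand)"
  have r_max: "card (idx T) \<le> r" if "T \<in> cand" for T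
    unfolding r_def using that fin_cand by simp
  have T0c: "T0 \<in> cand" using T0 c0 unfolding cand_def by simp
  have "r \<ge> 1"
  proof -
    have "idx T0 \<noteq> {}" using T0 unfolding idx_def by auto
    then have "card (idx T0) \<ge> 1" using fin_idx T0 by (simp add: Suc_le_eq card_gt_0_iff)
    then show ?thesis using r_max[OF T0c] by simp
  qed
  obtain T1 where "T1 \<in> cand" "card (idx T1) = r"
    using Max_in[of "(\<lambda>T. card (idx T)) ` cand"] fin_cand T0c unfolding r_def by fastforce
  then obtain T where T: "T \<in> cand" "card (idx T) = r"
      and T_min: "\<And>S. S \<in> cand \<Longrightarrow> card (idx S) = r \<Longrightarrow> card T \<le> card S"
    using ex_has_least_nat[of "\<lambda>T. T \<in> cand \<and> card (idx T) = r" T1 card] by blast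
  have Tlow: "T \<subseteq> low" "card T \<le> k" "coef T \<noteq> 0" using T unfolding cand_def by auto
  have finT: "finite T" using Tlow finite_low finite_subset by blast
  have Td: "card T \<le> d" using coef_eq_0[of T] Tlow by fastforce
  have "r \<le> card (fst ` T)"
    unfolding T(2)[symmetric] idx_def using finT by (intro card_mono) auto
  also have "\<dots> \<le> d" using card_image_le[OF finT, of fst] Td by simp
  finally have rd: "r \<le> d" .

  obtain h where h: "bij_betw h {..<r} (idx T)" "strict_mono_on {..<r} h"
    using ex_bij_betw_strict_mono_card[OF fin_idx[OF Tlow(1)]] T(2) by metis
  have hinj: "inj_on h {..<r}" and hidx: "h ` {..<r} = idx T"
    using h(1) by (simp_all add: bij_betw_def)
  (* The p-th part of T goes to block 2p+1, or to block 2p+2 if p is in e.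
     Every such placement keeps the order of the parts and fixes the core. *)
  define rk where "rk = the_inv_into {..<r} h"
  have rk_h: "rk (h p) = p" if "p < r" for p
    unfolding rk_def using the_inv_into_f_f[OF hinj] that by simp
  define \<psi> where "\<psi> e i = (if i = 0 then 0 else 2 * rk i + 1 + (if rk i \<in> e then 1 else 0))"
    for e and i :: nat
  have h_pos: "h p > 0" if "p < r" for p
  proof -
    have "h p \<in> idx T" using hidx that by blast
    then show ?thesis unfolding idx_def by simp
  qed
  have \<psi>0: "\<psi> e 0 = 0" for e unfolding \<psi>_def by simp
  have \<psi>h: "\<psi> e (h p) = 2 * p + 1 + (if p \<in> e then 1 else 0)" if "p < r" for e p
    using rk_h[OF that] h_pos[OF that] unfolding \<psi>_def by auto
  have fstT: "i = 0 \<or> (\<exists>p<r. i = h p)" if "i \<in> fst ` T" for i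
  proof (cases "i = 0")
    case False
    then have "i \<in> h ` {..<r}" using that unfolding hidx idx_def by simp
    then show ?thesis by auto
  qed simp
  have mono\<psi>: "strict_mono_on (fst ` T) (\<psi> e)" for e
  proof (rule strict_mono_onI)
    fix i j assume i: "i \<in> fst ` T" and j: "j \<in> fst ` T" and ij: "i < j"
    obtain q where q: "q < r" "j = h q" using fstT[OF j] ij by auto
    show "\<psi> e i < \<psi> e j"
    proof (cases "i = 0")
      case True
      then show ?thesis using \<psi>h[OF q(1)] q(2) \<psi>0 by simp
    next
      case False
      then obtain p where p: "p < r" "i = h p" using fstT[OF i] by auto
      have "p < q"
      proof (rule ccontr)
        assume "\<not> p < q"
        then have "q = p \<or> h q < h p"
          using strict_mono_onD[OF h(2), of q p] p q by fastforce
        then show False using ij p q by auto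
      qed
      then show ?thesis using \<psi>h[OF p(1), of e] \<psi>h[OF q(1), of e] p q by simp
    qed
  qed
  define copy where "copy e = map_prod (\<psi> e) (id :: nat \<Rightarrow> nat) ` T" for e
  have copy_low: "copy e \<subseteq> low" for e
  proof
    fix x assume "x \<in> copy e"
    then obtain i t where x: "x = (\<psi> e i, t)" and it: "(i, t) \<in> T" unfolding copy_def by auto
    then have itl: "(i, t) \<in> low" using Tlow by blast
    have iT: "i \<in> fst ` T" using it by force
    consider "i = 0" | p where "p < r" "i = h p" using fstT[OF iT] by blast
    then show "x \<in> low"
    proof cases
      case 1
      then show ?thesis using itl x \<psi>0 by simp
    next
      case 2
      then have "i > 0" using h_pos by simp
      then have "t \<in> Lab" using itl unfolding low_def by auto
      moreover have "0 < \<psi> e i" "\<psi> e i \<le> 2 * d" using \<psi>h[OF 2(1), of e] 2 rd by auto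
      ultimately show ?thesis unfolding x low_def by simp
    qed
  qed
  have coef_copy: "coef (copy e) = coef T" and card_copy: "card (copy e) = card T" for e
    unfolding copy_def
    using coef_order_invariant[OF Tlow(1,2) mono\<psi>] copy_low unfolding copy_def by auto

  (* Both copies of every part, and the core part of T once.
     This is where 2 * d \<le> k is needed. *)
  define Big where "Big = copy {} \<union> copy {..<r}"
  have Big_low: "Big \<subseteq> low" unfolding Big_def using copy_low by blast
  have finBig: "finite Big" using Big_low finite_low finite_subset by blast
  have "card Big \<le> card (copy {}) + card (copy {..<r})"
    unfolding Big_def by (rule card_Un_le)
  then have Big_k: "card Big \<le> k" using card_copy Td dk by simp
  have Big_cases: "(x = (0, t) \<and> (0, t) \<in> T) \<or>
      (\<exists>p<r. (h p, t) \<in> T \<and> (fst x = 2 * p + 1 \<or> fst x = 2 * p + 2))"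
    if xB: "x \<in> Big" and tx: "t = snd x" for x t
  proof -
    obtain e where "x \<in> copy e" using xB unfolding Big_def by blast
    then obtain i where x: "x = (\<psi> e i, t)" and it: "(i, t) \<in> T"
      unfolding tx copy_def by auto
    have iT: "i \<in> fst ` T" using it by force
    consider "i = 0" | p where "p < r" "i = h p" using fstT[OF iT] by blast
    then show ?thesis
    proof cases
      case 1
      then show ?thesis using x it \<psi>0 by simp
    next
      case 2
      then show ?thesis using x it \<psi>h[OF 2(1), of e] by auto
    qed
  qed
  have copy_Big: "copy e \<subseteq> Big" for e
  proof
    fix x assume "x \<in> copy e"
    then obtain i t where x: "x = (\<psi> e i, t)" and it: "(i, t) \<in> T" unfolding copy_def by auto
    have iT: "i \<in> fst ` T" using it by force
    consider "i = 0" | p where "p < r" "i = h p" using fstT[OF iT] by blast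
    then have "\<psi> e i = \<psi> {} i \<or> \<psi> e i = \<psi> {..<r} i"
      by cases (auto simp: \<psi>0 \<psi>h)
    then show "x \<in> Big" using x it unfolding Big_def copy_def by force
  qed

  (* The blocks 2p+1 and 2p+2 form group p. *)
  define grp where "grp i = (i - 1) div 2" for i :: nat
  define grps where "grps S = grp ` idx S" for S
  define part where "part \<epsilon> = {x \<in> Big. fst x = 0 \<or> grp (fst x) \<in> \<epsilon>}" for \<epsilon>
  have grp_simps: "grp (2 * p + 1) = p" "grp (2 * p + 2) = p" for p
    unfolding grp_def by auto
  have part_iff: "S \<subseteq> part \<epsilon> \<longleftrightarrow> grps S \<subseteq> \<epsilon>" if "S \<subseteq> Big" for S \<epsilon>
    using that unfolding part_def grps_def idx_def by force
  have grps_r: "grps S \<subseteq> {..<r}" if SB: "S \<subseteq> Big" for S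
  proof
    fix p assume "p \<in> grps S"
    then obtain x where x: "x \<in> S" "fst x \<noteq> 0" "p = grp (fst x)" unfolding grps_def idx_def by auto
    have "x \<in> Big" using SB x(1) by blast
    then obtain q where "q < r" "fst x = 2 * q + 1 \<or> fst x = 2 * q + 2"
      using Big_cases[OF _ refl] x(2) by (metis fst_conv)
    then show "p \<in> {..<r}" using x grp_simps by auto
  qed

  define \<sigma> where "\<sigma> = (\<Sum>\<epsilon>\<in>Pow {..<r}. (-1) ^ card \<epsilon> * F (part \<epsilon>))"
  have upper: "2 * \<bar>\<sigma>\<bar> \<le> 2 ^ r"
  proof -
    (* Subtracting the vanishing alternating sum of a constant replaces the values 0 and 1
       by values of absolute value 1/2, which gains the factor 2 over the trivial bound. *)
    have zero: "(\<Sum>\<epsilon>\<in>Pow {..<r}. (-1) ^ card \<epsilon> * (1 :: int)) = 0"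
      by (rule alternating_sum_eq_0_if_toggle_invariant[of _ 0]) (use \<open>r \<ge> 1\<close> in auto)
    have "2 * \<sigma> = (\<Sum>\<epsilon>\<in>Pow {..<r}. (-1) ^ card \<epsilon> * (2 * F (part \<epsilon>) - 1))"
      using zero unfolding \<sigma>_def
      by (simp add: right_diff_distrib sum_subtractf sum_distrib_left mult.left_commute)
    then have "\<bar>2 * \<sigma>\<bar> \<le> (\<Sum>\<epsilon>\<in>Pow {..<r}. \<bar>(-1) ^ card \<epsilon> * (2 * F (part \<epsilon>) - 1)\<bar>)"
      by (simp only: sum_abs)
    also have "\<dots> = (\<Sum>\<epsilon>\<in>Pow {..<r}. 1)"
    proof (intro sum.cong refl)
      fix \<epsilon> show "\<bar>(-1) ^ card \<epsilon> * (2 * F (part \<epsilon>) - 1)\<bar> = 1"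
        using F_boolean[of "part \<epsilon>"] by (auto simp: abs_mult)
    qed
    also have "\<dots> = 2 ^ r" by (simp add: card_Pow)
    finally show ?thesis by simp
  qed

  (* The sets whose coefficients survive in the alternating sum. *)
  define full where "full = {S. S \<subseteq> Big \<and> grps S = {..<r} \<and> coef S \<noteq> 0}"
  have full_eq: "full = copy ` Pow {..<r}"
  proof
    show "copy ` Pow {..<r} \<subseteq> full"
    proof
      fix S assume "S \<in> copy ` Pow {..<r}"
      then obtain e where S: "S = copy e" by blast
      have "{..<r} \<subseteq> grps S"
      proof
        fix p assume "p \<in> {..<r}"
        then have p: "p < r" by simp
        then have "h p \<in> fst ` T" using hidx unfolding idx_def by blast
        then have "\<psi> e (h p) \<in> fst ` S" unfolding S copy_def by force
        then have "\<psi> e (h p) \<in> idx S" unfolding idx_def using \<psi>h[OF p] by simp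
        moreover have "grp (\<psi> e (h p)) = p" using \<psi>h[OF p, of e] grp_simps[of p] by auto
        ultimately show "p \<in> grps S" unfolding grps_def by force
      qed
      then show "S \<in> full"
        unfolding full_def using grps_r copy_Big S coef_copy Tlow by auto
    qed
    show "full \<subseteq> copy ` Pow {..<r}"
    proof
      fix S assume "S \<in> full"
      then have S: "S \<subseteq> Big" "grps S = {..<r}" "coef S \<noteq> 0" unfolding full_def by auto
      have Slow: "S \<subseteq> low" using S Big_low by blast
      have finS: "finite S" using S finBig finite_subset by blast
      have Sk: "card S \<le> k" using card_mono[OF finBig S(1)] Big_k by simp
      have Sc: "S \<in> cand" unfolding cand_def using Slow Sk S(3) by simp
      (* S meets at least r blocks, hence exactly r by maximality, hence one block of each group.
         So it is contained in one of the copies of T, and it equals that copy by minimality. *)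
      have "r \<le> card (idx S)"
        using card_image_le[OF fin_idx[OF Slow], of grp] S(2) unfolding grps_def by simp
      then have cS: "card (idx S) = r" using r_max[OF Sc] by simp
      then have inj: "inj_on grp (idx S)"
        using S(2) fin_idx[OF Slow] unfolding grps_def by (simp add: eq_card_imp_inj_on)
      define e where "e = {p. p < r \<and> 2 * p + 2 \<in> idx S}"
      have "S \<subseteq> copy e"
      proof
        fix x assume x: "x \<in> S"
        define t where "t = snd x"
        have xB: "x \<in> Big" using x S by blast
        consider "x = (0, t)" "(0, t) \<in> T"
          | p where "p < r" "(h p, t) \<in> T" "fst x = 2 * p + 1 \<or> fst x = 2 * p + 2"
          using Big_cases[OF xB t_def] by blast
        then show "x \<in> copy e"
        proof cases
          case 1
          then show ?thesis unfolding copy_def using \<psi>0[of e] by force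
        next
          case 2
          have xi: "fst x \<in> idx S" using 2 x unfolding idx_def by force
          have "fst x = \<psi> e (h p)"
          proof (cases "fst x = 2 * p + 2")
            case True
            then have "p \<in> e" using xi 2 unfolding e_def by simp
            then show ?thesis using \<psi>h[OF 2(1)] True by simp
          next
            case False
            have "p \<notin> e"
            proof
              assume "p \<in> e"
              then have "2 * p + 2 \<in> idx S" unfolding e_def by simp
              then have "2 * p + 2 = fst x"
                using inj_onD[OF inj, of "2 * p + 2" "fst x"] xi 2(3) grp_simps[of p] by auto
              then show False using False by simp
            qed
            then show ?thesis using \<psi>h[OF 2(1)] 2(3) False by simp
          qed
          then have "x = map_prod (\<psi> e) id (h p, t)" unfolding t_def by (simp add: prod_eq_iff)
          then show ?thesis unfolding copy_def using 2(2) by blast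
        qed
      qed
      moreover have "card (copy e) \<le> card S" using T_min[OF Sc cS] card_copy by simp
      moreover have "finite (copy e)" unfolding copy_def using finT by simp
      ultimately have "S = copy e" using card_seteq by blast
      then show "S \<in> copy ` Pow {..<r}" unfolding e_def by blast
    qed
  qed
  have card_full: "card full = 2 ^ r"
  proof -
    have "inj_on copy (Pow {..<r})"
    proof (rule inj_onI)
      fix e e' assume e: "e \<in> Pow {..<r}" "e' \<in> Pow {..<r}" and eq: "copy e = copy e'"
      have key: "p \<in> e \<longleftrightarrow> 2 * p + 2 \<in> fst ` copy e" if p: "p < r" for p e
      proof
        assume "p \<in> e"
        then have "\<psi> e (h p) = 2 * p + 2" using \<psi>h[OF p, of e] by simp
        moreover have "h p \<in> fst ` T" using hidx p unfolding idx_def by blast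
        ultimately show "2 * p + 2 \<in> fst ` copy e" unfolding copy_def by force
      next
        assume "2 * p + 2 \<in> fst ` copy e"
        then obtain i where i: "i \<in> fst ` T" "2 * p + 2 = \<psi> e i" unfolding copy_def by force
        then obtain q where q: "q < r" "i = h q" using fstT[OF i(1)] \<psi>0 by auto
        then have "2 * p + 2 = 2 * q + 1 + (if q \<in> e then 1 else 0)" using i \<psi>h by simp
        then show "p \<in> e" by (cases "q \<in> e") (simp, presburger)
      qed
      have "p \<in> e \<longleftrightarrow> p \<in> e'" if "p < r" for p
        using key[OF that, of e] key[OF that, of e'] eq by simp
      then show "e = e'" using e by auto
    qed
    then show ?thesis unfolding full_eq by (simp add: card_image card_Pow)
  qed

  have "\<sigma> = (\<Sum>\<epsilon>\<in>Pow {..<r}. \<Sum>S\<in>Pow Big.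
      (-1) ^ card S * coef S * ((-1) ^ card \<epsilon> * (if grps S \<subseteq> \<epsilon> then 1 else 0)))"
    unfolding \<sigma>_def
  proof (intro sum.cong refl)
    fix \<epsilon>
    have finp: "finite (part \<epsilon>)" unfolding part_def using finBig by simp
    have "F (part \<epsilon>) = (\<Sum>S\<in>Pow (part \<epsilon>). (-1) ^ card S * coef S)"
      by (rule F_eq_sum_coef[OF finp])
    also have "\<dots> = (\<Sum>S\<in>Pow Big. if S \<subseteq> part \<epsilon> then (-1) ^ card S * coef S else 0)"
      by (rule sum.mono_neutral_cong_left) (use finBig in \<open>auto simp: part_def\<close>)
    also have "\<dots> = (\<Sum>S\<in>Pow Big. if grps S \<subseteq> \<epsilon> then (-1) ^ card S * coef S else 0)"
      by (intro sum.cong refl) (simp add: part_iff)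
    finally show "(-1) ^ card \<epsilon> * F (part \<epsilon>) = (\<Sum>S\<in>Pow Big.
      (-1) ^ card S * coef S * ((-1) ^ card \<epsilon> * (if grps S \<subseteq> \<epsilon> then 1 else 0)))"
      by (simp add: sum_distrib_left if_distrib mult_ac cong: if_cong)
  qed
  also have "\<dots> = (\<Sum>S\<in>Pow Big. (-1) ^ card S * coef S *
      (\<Sum>\<epsilon>\<in>Pow {..<r}. (-1) ^ card \<epsilon> * (if grps S \<subseteq> \<epsilon> then 1 else 0)))"
    by (subst sum.swap) (simp add: sum_distrib_left)
  also have "\<dots> = (\<Sum>S\<in>full. (-1) ^ card S * coef S * (-1) ^ r)"
  proof (rule sum.mono_neutral_cong_right)
    show "finite (Pow Big)" using finBig by simp
    show "full \<subseteq> Pow Big" unfolding full_def by auto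
    show "\<forall>S\<in>Pow Big - full. (-1) ^ card S * coef S *
      (\<Sum>\<epsilon>\<in>Pow {..<r}. (-1) ^ card \<epsilon> * (if grps S \<subseteq> \<epsilon> then 1 else 0)) = 0"
    proof
      fix S assume S: "S \<in> Pow Big - full"
      show "(-1) ^ card S * coef S *
        (\<Sum>\<epsilon>\<in>Pow {..<r}. (-1) ^ card \<epsilon> * (if grps S \<subseteq> \<epsilon> then 1 else 0)) = 0"
      proof (cases "coef S = 0")
        case False
        then obtain p where p: "p < r" "p \<notin> grps S"
          using S grps_r[of S] unfolding full_def by auto
        have "(\<Sum>\<epsilon>\<in>Pow {..<r}. (-1) ^ card \<epsilon> * (if grps S \<subseteq> \<epsilon> then 1 else (0 :: int))) = 0"
          by (rule alternating_sum_eq_0_if_toggle_invariant[of _ p]) (use p in auto)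
        then show ?thesis by simp
      qed simp
    qed
    fix S assume "S \<in> full"
    then have S: "grps S = {..<r}" unfolding full_def by simp
    have "(\<Sum>\<epsilon>\<in>Pow {..<r}. (-1) ^ card \<epsilon> * (if grps S \<subseteq> \<epsilon> then 1 else (0 :: int)))
        = (\<Sum>\<epsilon>\<in>{{..<r}}. (-1) ^ card \<epsilon> * (if grps S \<subseteq> \<epsilon> then 1 else 0))"
      by (rule sum.mono_neutral_right) (use S in auto)
    then show "(-1) ^ card S * coef S *
        (\<Sum>\<epsilon>\<in>Pow {..<r}. (-1) ^ card \<epsilon> * (if grps S \<subseteq> \<epsilon> then 1 else 0))
        = (-1) ^ card S * coef S * (-1) ^ r"
      using S by simp
  qed
  also have "\<dots> = (\<Sum>S\<in>full. (-1) ^ card T * coef T * (-1) ^ r)"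
    by (intro sum.cong refl) (auto simp: full_eq coef_copy card_copy)
  also have "\<dots> = 2 ^ r * ((-1) ^ card T * coef T * (-1) ^ r)"
    by (simp add: card_full)
  finally have "\<bar>\<sigma>\<bar> = 2 ^ r * \<bar>coef T\<bar>" by (simp add: abs_mult power_abs)
  moreover have "(2 :: int) ^ r * 1 \<le> 2 ^ r * \<bar>coef T\<bar>"
    using Tlow(3) by (intro mult_left_mono) auto
  moreover have "(0 :: int) < 2 ^ r" by simp
  ultimately show False using upper by linarith
qed

text \<open>
  A set of size \<open>k\<close> needs no padding, so \<open>G\<close> is the sum of the coefficients of its subsets, and only
  the subsets of the core contribute.
\<close>

lemma G_determined_by_core:
  assumes x: "x \<subseteq> low" "card x = k" and y: "y \<subseteq> low" "card y = k"
    and core: "{v \<in> x. fst v = 0} = {v \<in> y. fst v = 0}"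
  shows "G x = G y"
proof -
  have "G z = (\<Sum>T\<in>Pow {v \<in> z. fst v = 0}. (-1) ^ card T * coef T)"
    if z: "z \<subseteq> low" "card z = k" for z
  proof -
    have finz: "finite z" using z finite_low finite_subset by blast
    have "G z = F z" unfolding F_def pad_def using z by simp
    also have "\<dots> = (\<Sum>T\<in>Pow z. (-1) ^ card T * coef T)" by (rule F_eq_sum_coef[OF finz])
    also have "\<dots> = (\<Sum>T\<in>Pow {v \<in> z. fst v = 0}. (-1) ^ card T * coef T)"
    proof (rule sum.mono_neutral_right)
      show "\<forall>T\<in>Pow z - Pow {v \<in> z. fst v = 0}. (-1) ^ card T * coef T = 0"
      proof
        fix T assume T: "T \<in> Pow z - Pow {v \<in> z. fst v = 0}"
        then have "card T \<le> k" using card_mono[OF finz, of T] z by simp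
        then have "coef T = 0" using T z by (intro coef_eq_0_if_noncore) auto
        then show "(-1) ^ card T * coef T = 0" by simp
      qed
    qed (use finz in auto)
    finally show ?thesis .
  qed
  then show ?thesis using x y core by simp
qed

end

section \<open>The junta bound for set functions\<close>

lemma swap_degree_le_vimage:
  assumes deg: "swap_degree_le V k d g" and f: "inj_on f W" "f ` W \<subseteq> V"
  shows "swap_degree_le W k d (\<lambda>X. g (f ` X))"
  unfolding swap_degree_le_def
proof (intro allI impI, elim conjE)
  fix X A w
  assume X: "X \<subseteq> W" "card X = k" and A: "A \<subseteq> W - X" "d < card A"
    and w: "inj_on w A" "w ` A \<subseteq> X"
  have fX: "inj_on f X" and fA: "inj_on f A" using X A f(1) by (auto intro: inj_on_subset)
  define w' where "w' y = f (w (the_inv_into A f y))" for y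
  have w'f: "w' (f u) = f (w u)" if "u \<in> A" for u
    unfolding w'_def using the_inv_into_f_f[OF fA that] by simp
  have "(\<Sum>U\<in>Pow (f ` A). (-1) ^ card U * g (f ` X - w' ` U \<union> U)) = 0"
  proof (rule swap_degree_leD[OF deg])
    show "f ` X \<subseteq> V" using X f by blast
    show "card (f ` X) = k" using X fX by (simp add: card_image)
    show "f ` A \<subseteq> V - f ` X" using A X f unfolding inj_on_def by blast
    show "d < card (f ` A)" using A fA by (simp add: card_image)
    show "inj_on w' (f ` A)"
    proof (rule inj_onI)
      fix y z assume y: "y \<in> f ` A" "z \<in> f ` A" and eq: "w' y = w' z"
      obtain u v where uv: "u \<in> A" "y = f u" "v \<in> A" "z = f v" using y by blast
      then have "f (w u) = f (w v)" using eq w'f by simp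
      then have "w u = w v" using fX w(2) uv by (meson image_subset_iff inj_onD)
      then show "y = z" using w(1) uv by (metis inj_onD)
    qed
    show "w' ` f ` A \<subseteq> f ` X" using w'f w(2) by (auto simp: image_subset_iff)
  qed
  moreover have "(\<Sum>U\<in>Pow (f ` A). (-1) ^ card U * g (f ` X - w' ` U \<union> U))
      = (\<Sum>U\<in>Pow A. (-1) ^ card U * g (f ` (X - w ` U \<union> U)))"
  proof -
    have "(\<Sum>U\<in>Pow (f ` A). (-1) ^ card U * g (f ` X - w' ` U \<union> U))
        = (\<Sum>U\<in>image f ` Pow A. (-1) ^ card U * g (f ` X - w' ` U \<union> U))"
      by (simp add: image_Pow_surj[OF refl])
    also have "\<dots> = (\<Sum>U\<in>Pow A. (-1) ^ card (f ` U) * g (f ` X - w' ` f ` U \<union> f ` U))"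
      using inj_on_image_Pow[OF fA] by (simp add: sum.reindex)
    also have "\<dots> = (\<Sum>U\<in>Pow A. (-1) ^ card U * g (f ` (X - w ` U \<union> U)))"
    proof (intro sum.cong refl)
      fix U assume U: "U \<in> Pow A"
      have "card (f ` U) = card U" using U fA by (meson PowD card_image inj_on_subset)
      moreover have "w' ` f ` U = f ` w ` U"
        unfolding image_image using w'f U by (intro image_cong) auto
      moreover have "f ` (X - w ` U) = f ` X - f ` w ` U"
        using fX w(2) U by (intro inj_on_image_set_diff) auto
      ultimately show "(-1) ^ card (f ` U) * g (f ` X - w' ` f ` U \<union> f ` U)
          = (-1) ^ card U * g (f ` (X - w ` U \<union> U))" by (simp add: image_Un)
    qed
    finally show ?thesis .
  qed
  ultimately show "(\<Sum>U\<in>Pow A. (-1) ^ card U * g (f ` (X - w ` U \<union> U))) = 0" by simp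
qed

text \<open>
  The block of a sensitive pair \<open>(a, b)\<close> is a witness \<open>X\<close> together with \<open>b\<close>. It carries the
  labels up to \<open>k\<close>, with \<open>0\<close> for \<open>a\<close> and \<open>1\<close> for \<open>b\<close>, so that omitting the label \<open>1\<close> gives \<open>X\<close>
  and omitting the label \<open>0\<close> gives the set after the exchange.
\<close>

lemma enumerate_sensitive_pair:
  assumes "sensitive V k g (a, b)" "finite V"
  shows "\<exists>e :: nat \<Rightarrow> 'a. inj_on e {..<k + 1} \<and> e ` {..<k + 1} \<subseteq> V \<and> e 0 = a \<and> e 1 = b \<and>
           g (e ` ({..<k + 1} - {0})) \<noteq> g (e ` ({..<k + 1} - {1}))"
proof -
  obtain X where X: "X \<subseteq> V" "card X = k" "a \<in> X" "b \<notin> X" "g (insert b (X - {a})) \<noteq> g X"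
    and ab: "a \<in> V" "b \<in> V" "a \<noteq> b"
    using assms(1) unfolding sensitive_def by auto
  have finX: "finite X" using X assms finite_subset by blast
  then have k: "k \<ge> 1" using X by (metis One_nat_def Suc_leI card_gt_0_iff empty_iff)
  have "card (X - {a}) = k - 1" using X finX by simp
  then obtain q where q: "bij_betw q {0..<k - 1} (X - {a})"
    using ex_bij_betw_nat_finite[of "X - {a}"] finX by auto
  have qX: "q ` {0..<k - 1} = X - {a}" and qinj: "inj_on q {0..<k - 1}"
    using q by (simp_all add: bij_betw_def)
  define e where "e t = (if t = 0 then a else if t = 1 then b else q (t - 2))" for t :: nat
  have rest: "e ` {2..<k + 1} = X - {a}"
  proof -
    have "{2..<k + 1} = (\<lambda>t. t + 2) ` {0..<k - 1}"
    proof -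
      have "0 + 2 = (2 :: nat)" "k - 1 + 2 = k + 1" using k by auto
      then show ?thesis using image_add_atLeastLessThan'[of 2 0 "k - 1"] by metis
    qed
    then have "e ` {2..<k + 1} = (\<lambda>t. e (t + 2)) ` {0..<k - 1}" by (simp only: image_image)
    also have "(\<lambda>t. e (t + 2)) = q" by (simp add: e_def)
    finally show ?thesis using qX by simp
  qed
  have "{..<k + 1} - {1} = insert 0 {2..<k + 1}" "{..<k + 1} - {0} = insert 1 {2..<k + 1}"
    using k by auto
  moreover have e01: "e 0 = a" "e 1 = b" by (simp_all add: e_def)
  ultimately have im: "e ` ({..<k + 1} - {1}) = X" "e ` ({..<k + 1} - {0}) = insert b (X - {a})"
    by (simp_all only: image_insert rest insert_Diff[OF X(3)])
  have all: "e ` {..<k + 1} = insert b X"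
  proof -
    have "{..<k + 1} = insert 1 ({..<k + 1} - {1})" using k by auto
    then have "e ` {..<k + 1} = insert (e 1) (e ` ({..<k + 1} - {1}))" by (metis image_insert)
    then show ?thesis using im e01 by simp
  qed
  moreover have "card (insert b X) = k + 1" using X finX by simp
  ultimately have "inj_on e {..<k + 1}" by (intro eq_card_imp_inj_on) simp_all
  moreover have "e ` {..<k + 1} \<subseteq> V" using all X ab by simp
  ultimately show ?thesis using im e01 X(5) by (intro exI[of _ e]) simp
qed

text \<open>
  In a homogeneous subfamily, the labels \<open>0\<close> and \<open>1\<close> lie outside the core since the pairs are
  disjoint. The two sets that witness the sensitivity of one pair then have the same core part, so
  \<open>g\<close> cannot distinguish them.
\<close>

lemma disjoint_sensitive_pairs_bounded:
  fixes d :: nat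
  assumes "d \<ge> 1"
  shows "\<exists>M. \<forall>(V :: 'a set) g P. finite V \<and> range g \<subseteq> {0, 1} \<and> swap_degree_le V (2 * d) d g \<and>
     finite P \<and> disjoint_pairs P \<and> (\<forall>p\<in>P. sensitive V (2 * d) g p) \<longrightarrow> card P < M"
proof -
  define k where "k = 2 * d"
  define N where "N = 2 * d + 1 + k"
  define L where "L = k + 1"
  have k2: "2 \<le> k" and N3: "3 \<le> N" unfolding k_def N_def using assms by auto
  obtain M where M: "\<forall>(e :: nat \<Rightarrow> nat \<Rightarrow> 'a) (g :: 'a set \<Rightarrow> int).
     range g \<subseteq> {0, 1} \<and> (\<forall>j<M. inj_on (e j) {..<L}) \<longrightarrow>
     (\<exists>l. strict_mono_on {..<N} l \<and> l ` {..<N} \<subseteq> {..<M} \<and> homogeneous_family N k L (e \<circ> l) g)"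
    using ex_homogeneous_subfamily[OF k2 N3, of L] by (rule exE)
  show ?thesis
  proof (intro exI[of _ M] allI impI, elim conjE, rule ccontr)
    fix V :: "'a set" and g P
    assume finV: "finite V" and g: "range g \<subseteq> {0, 1}" and deg: "swap_degree_le V (2 * d) d g"
      and P: "finite P" "disjoint_pairs P" "\<forall>p\<in>P. sensitive V (2 * d) g p"
      and big: "\<not> card P < M"
    obtain h where h: "bij_betw h {0..<card P} P" using ex_bij_betw_nat_finite[OF P(1)] by blast
    have hP: "h j \<in> P" if "j < M" for j
      using h big that unfolding bij_betw_def by (metis atLeastLessThan_iff imageI le0 not_less order.strict_trans2)
    have hne: "h i \<noteq> h j" if "i < M" "j < M" "i \<noteq> j" for i j
      using bij_betw_imp_inj_on[OF h] big that by (auto simp: inj_on_def)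
    have "\<exists>e :: nat \<Rightarrow> 'a. inj_on e {..<L} \<and> e ` {..<L} \<subseteq> V \<and> e 0 = fst (h j) \<and> e 1 = snd (h j) \<and>
           g (e ` ({..<L} - {0})) \<noteq> g (e ` ({..<L} - {1}))" if "j < M" for j
      using enumerate_sensitive_pair[of V k g "fst (h j)" "snd (h j)"] hP[OF that] P(3) finV
      unfolding L_def k_def by simp
    then obtain e :: "nat \<Rightarrow> nat \<Rightarrow> 'a" where e:
      "\<And>j. j < M \<Longrightarrow> inj_on (e j) {..<L}" "\<And>j. j < M \<Longrightarrow> e j ` {..<L} \<subseteq> V"
      "\<And>j. j < M \<Longrightarrow> e j 0 = fst (h j)" "\<And>j. j < M \<Longrightarrow> e j 1 = snd (h j)"
      "\<And>j. j < M \<Longrightarrow> g (e j ` ({..<L} - {0})) \<noteq> g (e j ` ({..<L} - {1}))"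
      by metis
    have "\<exists>l. strict_mono_on {..<N} l \<and> l ` {..<N} \<subseteq> {..<M} \<and> homogeneous_family N k L (e \<circ> l) g"
      by (rule M[rule_format]) (use g e(1) in simp)
    then obtain l where l: "strict_mono_on {..<N} l" "l ` {..<N} \<subseteq> {..<M}"
      and hom: "homogeneous_family N k L (e \<circ> l) g"
      by blast
    have sun: "\<forall>i<N. \<forall>j<N. \<forall>s<L. \<forall>t<L. i \<noteq> j \<and> e (l i) s = e (l j) t \<longrightarrow>
           s = t \<and> (\<forall>i'<N. e (l i') s = e (l 0) s)"
      and inv: "\<forall>X \<psi>. X \<subseteq> {..<N} \<times> {..<L} \<and> card (fst ` X) \<le> k \<and>
          strict_mono_on (fst ` X) \<psi> \<and> \<psi> ` fst ` X \<subseteq> {..<N} \<longrightarrow>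
          g ((\<lambda>(i, t). e (l i) t) ` X) = g ((\<lambda>(i, t). e (l (\<psi> i)) t) ` X)"
      using hom unfolding homogeneous_family_def o_def by (rule conjunct1, rule conjunct2)
    have lM: "l i < M" if "i < N" for i using l(2) that by auto
    have N1: "0 < N" "1 < N" using N3 by auto
    have L1: "0 < L" "1 < L" unfolding L_def using k2 by auto
    define Core where "Core = {t. t < L \<and> (\<forall>i<N. e (l i) t = e (l 0) t)}"
    define Lab where "Lab = {..<L} - Core"
    define \<epsilon> where "\<epsilon> = (\<lambda>(i, t). e (l i) t)"
    define Nd where "Nd = {0} \<times> Core \<union> {0<..<2 * d + 1 + k} \<times> Lab"
    have Nd_sub: "Nd \<subseteq> {..<N} \<times> {..<L}" unfolding Nd_def N_def Core_def Lab_def by auto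
    have "l 0 < l 1" using strict_mono_onD[OF l(1), of 0 1] N1 by simp
    then have ne01: "h (l 0) \<noteq> h (l 1)" using hne lM N1 by (metis less_irrefl)
    then have "{fst (h (l 0)), snd (h (l 0))} \<inter> {fst (h (l 1)), snd (h (l 1))} = {}"
      using P(2) hP lM N1 unfolding disjoint_pairs_def by blast
    then have "e (l 1) 0 \<noteq> e (l 0) 0" "e (l 1) 1 \<noteq> e (l 0) 1"
      using e(3,4) lM N1 by auto
    then have Lab01: "0 \<in> Lab" "1 \<in> Lab" unfolding Lab_def Core_def using L1 N1 by auto
    have inj\<epsilon>: "inj_on \<epsilon> Nd"
    proof (rule inj_onI, clarify)
      fix i s j t assume i: "(i, s) \<in> Nd" and j: "(j, t) \<in> Nd" and eq: "\<epsilon> (i, s) = \<epsilon> (j, t)"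
      have b: "i < N" "s < L" "j < N" "t < L" using i j Nd_sub by auto
      have eq': "e (l i) s = e (l j) t" using eq unfolding \<epsilon>_def by simp
      show "i = j \<and> s = t"
      proof (cases "i = j")
        case True
        then show ?thesis using eq' e(1)[OF lM[OF b(1)]] b by (auto simp: inj_on_def)
      next
        case False
        then have "s = t \<and> (\<forall>i'<N. e (l i') s = e (l 0) s)" using sun b eq' by blast
        then have "s \<in> Core" "t \<in> Core" unfolding Core_def using b by auto
        then have "i = 0" "j = 0" using i j unfolding Nd_def Lab_def by auto
        then show ?thesis using False by simp
      qed
    qed
    have \<epsilon>V: "\<epsilon> ` Nd \<subseteq> V"
    proof
      fix v assume "v \<in> \<epsilon> ` Nd"
      then obtain i t where "(i, t) \<in> Nd" "v = e (l i) t" unfolding \<epsilon>_def by auto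
      then show "v \<in> V" using e(2)[OF lM, of i] Nd_sub by blast
    qed
    interpret homogeneous_nodes d k Core Lab 1 "\<lambda>X. g (\<epsilon> ` X)"
    proof
      show "finite Core" unfolding Core_def by simp
      show "finite Lab" unfolding Lab_def by simp
      show "1 \<in> Lab" by (rule Lab01)
      show "2 * d \<le> k" unfolding k_def by simp
      show "range (\<lambda>X. g (\<epsilon> ` X)) \<subseteq> {0, 1}" using g by auto
      show "swap_degree_le ({0} \<times> Core \<union> {0<..<2 * d + 1 + k} \<times> Lab) k d (\<lambda>X. g (\<epsilon> ` X))"
        using swap_degree_le_vimage[OF deg inj\<epsilon> \<epsilon>V] unfolding Nd_def k_def .
      fix X \<psi> assume X: "X \<subseteq> {0} \<times> Core \<union> {0<..<2 * d + 1 + k} \<times> Lab" "card X = k"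
        and \<psi>: "strict_mono_on (fst ` X) \<psi>"
        and im: "map_prod \<psi> id ` X \<subseteq> {0} \<times> Core \<union> {0<..<2 * d + 1 + k} \<times> Lab"
      have XN: "X \<subseteq> {..<N} \<times> {..<L}" using X(1) Nd_sub unfolding Nd_def by blast
      have "finite X" using X(2) k2 by (metis card.infinite not_numeral_le_zero)
      then have "card (fst ` X) \<le> k" using X(2) card_image_le by metis
      moreover have "\<psi> ` fst ` X \<subseteq> {..<N}"
      proof -
        have "map_prod \<psi> id ` X \<subseteq> {..<N} \<times> {..<L}" using im Nd_sub unfolding Nd_def by blast
        then show ?thesis by fastforce
      qed
      ultimately have "g (\<epsilon> ` X) = g ((\<lambda>(i, t). e (l (\<psi> i)) t) ` X)"
        using inv XN \<psi> unfolding \<epsilon>_def by blast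
      also have "(\<lambda>(i, t). e (l (\<psi> i)) t) ` X = \<epsilon> ` map_prod \<psi> id ` X"
        unfolding image_image by (intro image_cong) (auto simp: \<epsilon>_def)
      finally show "g (\<epsilon> ` map_prod \<psi> id ` X) = g (\<epsilon> ` X)" by simp
    qed
    define x where "x c = {0 :: nat} \<times> Core \<union> {1} \<times> (Lab - {c})" for c
    have im: "\<epsilon> ` x c = e (l 1) ` ({..<L} - {c})" if c: "c \<in> Lab" for c
    proof -
      have "\<epsilon> ` x c = e (l 0) ` Core \<union> e (l 1) ` (Lab - {c})"
        unfolding x_def \<epsilon>_def by (force simp: image_Un)
      also have "e (l 0) ` Core = e (l 1) ` Core"
      proof (rule image_cong[OF refl])
        fix t assume "t \<in> Core"
        then have "\<forall>i<N. e (l i) t = e (l 0) t" unfolding Core_def by blast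
        then show "e (l 0) t = e (l 1) t" using N1(2) by metis
      qed
      also have "e (l 1) ` Core \<union> e (l 1) ` (Lab - {c}) = e (l 1) ` (Core \<union> (Lab - {c}))"
        by (simp add: image_Un)
      also have "Core \<union> (Lab - {c}) = {..<L} - {c}" using c unfolding Lab_def Core_def by auto
      finally show ?thesis .
    qed
    have card_x: "card (x c) = k" if c: "c \<in> Lab" for c
    proof -
      have "card (x c) = card ({0 :: nat} \<times> Core) + card ({1 :: nat} \<times> (Lab - {c}))"
        unfolding x_def by (rule card_Un_disjoint) (auto simp: fin_Core fin_Lab)
      also have "\<dots> = card Core + (card Lab - 1)"
        using c fin_Lab by (simp add: card_cartesian_product)
      also have "\<dots> = card Core + card Lab - 1"
        using c fin_Lab by (simp add: card_gt_0_iff Suc_le_eq) (metis Nat.add_diff_assoc One_nat_def Suc_leI card_gt_0_iff empty_iff)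
      also have "card Core + card Lab = L"
        unfolding Lab_def using card_Un_disjoint[of Core "{..<L} - Core"] fin_Core
        by (simp add: Un_absorb1 Core_def subset_iff)
      finally show ?thesis unfolding L_def by simp
    qed
    have low_x: "x c \<subseteq> low" for c unfolding x_def low_def using assms by auto
    have "g (\<epsilon> ` x 0) = g (\<epsilon> ` x 1)"
      by (rule G_determined_by_core)
        (use low_x card_x Lab01 in \<open>auto simp: x_def\<close>)
    then show False using e(5)[OF lM[OF N1(2)]] im Lab01 by simp
  qed
qed

text \<open>
  The reduction to weight \<open>2 * d\<close> keeps at least a fraction \<open>1 / 2 ^ (d + 2)\<close> of the sensitive
  pairs.
\<close>

lemma junta_bound:
  fixes d :: nat
  assumes "d \<ge> 1"
  shows "\<exists>m. \<forall>(V :: 'a set) k g. finite V \<and> 2 * d \<le> k \<and> 2 * k \<le> card V \<and> range g \<subseteq> {0, 1} \<and>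
     swap_degree_le V k d g \<longrightarrow>
     (\<exists>J \<subseteq> V. card J \<le> m \<and>
       (\<forall>X Y. X \<subseteq> V \<and> card X = k \<and> Y \<subseteq> V \<and> card Y = k \<and> X \<inter> J = Y \<inter> J \<longrightarrow> g X = g Y))"
proof -
  obtain M where M: "\<And>(V :: 'a set) g P. finite V \<Longrightarrow> range g \<subseteq> {0, 1} \<Longrightarrow>
     swap_degree_le V (2 * d) d g \<Longrightarrow> finite P \<Longrightarrow> disjoint_pairs P \<Longrightarrow>
     (\<forall>p\<in>P. sensitive V (2 * d) g p) \<Longrightarrow> card P < M"
    using disjoint_sensitive_pairs_bounded[OF assms, where 'a = 'a] by metis
  define D where "D = d + 2"
  show ?thesis
  proof (intro exI[of _ "2 * (2 ^ D * M)"] allI impI, elim conjE, rule ccontr)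
    fix V :: "'a set" and k g
    assume finV: "finite V" and k: "2 * d \<le> k" "2 * k \<le> card V" and g: "range g \<subseteq> {0, 1}"
      and deg: "swap_degree_le V k d g"
      and nj: "\<not> (\<exists>J \<subseteq> V. card J \<le> 2 * (2 ^ D * M) \<and>
       (\<forall>X Y. X \<subseteq> V \<and> card X = k \<and> Y \<subseteq> V \<and> card Y = k \<and> X \<inter> J = Y \<inter> J \<longrightarrow> g X = g Y))"
    obtain P where P: "finite P" "card P = Suc (2 ^ D * M)" "disjoint_pairs P"
        "\<forall>p\<in>P. sensitive V k g p"
      using junta_or_disjoint_sensitive_pairs[OF finV, of "2 ^ D * M" k g "Suc (2 ^ D * M)"] nj
      by (metis order_refl)
    define m where "m = k - 2 * d"
    have km: "k = 2 * d + m" unfolding m_def using k by simp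
    obtain V' g' P' where *: "finite V'" "P' \<subseteq> P" "range g' \<subseteq> {0, 1}"
        "swap_degree_le V' (2 * d) d g'" "\<forall>p\<in>P'. sensitive V' (2 * d) g' p"
        "card P * ((card V - m) choose D) \<le> card P' * (card V choose D)"
      using restrict_to_small_slice[of V "2 * d" m d g P] deg finV P g k assms
      unfolding km D_def by fastforce
    have "disjoint_pairs P'" using P(3) *(2) unfolding disjoint_pairs_def by blast
    moreover have "finite P'" using * P finite_subset by blast
    ultimately have "card P' < M" using M[of V' g' P'] * by blast
    define s where "s = card V - m"
    (* 2 * m = 2 * k - 4 * d is at most card V - 4 * d, and 4 * d is at least D. *)
    have s: "card V + D \<le> 2 * s" "s \<le> card V" unfolding s_def D_def m_def using k assms by auto
    then have pos: "0 < s choose D" unfolding D_def by (simp add: zero_less_binomial)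
    have "card P * (s choose D) \<le> card P' * (card V choose D)" using * unfolding s_def by simp
    also have "\<dots> \<le> card P' * (2 ^ D * (s choose D))"
      using binomial_le_two_power_mult[OF s] by (rule mult_left_mono) simp
    finally have "card P * (s choose D) \<le> (card P' * 2 ^ D) * (s choose D)" by (simp add: mult.assoc)
    then have "card P \<le> card P' * 2 ^ D" using pos by simp
    also have "\<dots> \<le> M * 2 ^ D" using \<open>card P' < M\<close> by simp
    finally show False using P(2) by (simp add: mult.commute)
  qed
qed

section \<open>Points of the slice as sets\<close>

definition ind :: "nat \<Rightarrow> nat set \<Rightarrow> nat \<Rightarrow> nat" where
  "ind n X = (\<lambda>i\<in>{1..n}. if i \<in> X then 1 else 0)"

lemma slice_eq_image_ind: "slice n k = ind n ` {X. X \<subseteq> {1..n} \<and> card X = k}"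
proof
  have sum: "(\<Sum>i = 1..n. ind n X i) = card X" if X: "X \<subseteq> {1..n}" for X
  proof -
    have "(\<Sum>i = 1..n. ind n X i) = (\<Sum>i = 1..n. if i \<in> X then 1 else 0)"
      by (intro sum.cong) (auto simp: ind_def)
    also have "\<dots> = card ({1..n} \<inter> X)" by (simp add: sum.If_cases)
    finally show ?thesis using X by (simp add: Int_absorb1)
  qed
  show "ind n ` {X. X \<subseteq> {1..n} \<and> card X = k} \<subseteq> slice n k"
    using sum by (auto simp: slice_def ind_def split: if_splits)
  show "slice n k \<subseteq> ind n ` {X. X \<subseteq> {1..n} \<and> card X = k}"
  proof
    fix x assume x: "x \<in> slice n k"
    define X where "X = {i \<in> {1..n}. x i = 1}"
    have "x i = ind n X i" for i
      using x unfolding slice_def ind_def X_def by (cases "i \<in> {1..n}") (auto simp: PiE_def extensional_def)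
    then have "x = ind n X" by blast
    moreover have "X \<subseteq> {1..n}" unfolding X_def by auto
    ultimately show "x \<in> ind n ` {X. X \<subseteq> {1..n} \<and> card X = k}"
      using x sum[of X] unfolding slice_def by auto
  qed
qed

lemma ind_mem_slice: "X \<subseteq> {1..n} \<Longrightarrow> card X = k \<Longrightarrow> ind n X \<in> slice n k"
  unfolding slice_eq_image_ind by blast

lemma prod_ind:
  assumes "finite K" "K \<subseteq> {1..n}" "\<And>i. i \<in> K \<Longrightarrow> m i > 0"
  shows "(\<Prod>i\<in>K. real (ind n X i) ^ m i) = (if K \<subseteq> X then 1 else 0)"
proof (cases "K \<subseteq> X")
  case True
  then have "real (ind n X i) ^ m i = 1" if "i \<in> K" for i
    using assms(2) that by (auto simp: ind_def)
  then show ?thesis using True by simp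
next
  case False
  then obtain i where "i \<in> K" "i \<notin> X" by blast
  then have "real (ind n X i) ^ m i = 0"
    using assms(2) assms(3)[of i] by (auto simp: ind_def)
  then show ?thesis using \<open>i \<in> K\<close> assms(1) False by auto
qed

lemma mpoly_eval_ind:
  assumes "in_vars {1..n} P"
  shows "mpoly_eval P (\<lambda>i. real (ind n X i)) =
    (\<Sum>u\<in>Poly_Mapping.keys P. Poly_Mapping.lookup P u * (if Poly_Mapping.keys u \<subseteq> X then 1 else 0))"
  unfolding mpoly_eval_def
proof (intro sum.cong refl)
  fix u assume "u \<in> Poly_Mapping.keys P"
  then have "Poly_Mapping.keys u \<subseteq> {1..n}" using assms unfolding in_vars_def by blast
  then have "(\<Prod>i\<in>Poly_Mapping.keys u. real (ind n X i) ^ Poly_Mapping.lookup u i)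
      = (if Poly_Mapping.keys u \<subseteq> X then 1 else 0)"
    by (intro prod_ind) (auto simp: in_keys_iff)
  then show "Poly_Mapping.lookup P u * (\<Prod>i\<in>Poly_Mapping.keys u. real (ind n X i) ^ Poly_Mapping.lookup u i)
      = Poly_Mapping.lookup P u * (if Poly_Mapping.keys u \<subseteq> X then 1 else 0)" by simp
qed

text \<open>
  The monomial given by \<open>K\<close> has fewer elements than there are exchanges, so it meets neither
  side of one of them, and toggling that exchange does not change its value.
\<close>

lemma alternating_sum_small_monomial:
  assumes "finite K" "card K < card A" "inj_on w A" "A \<inter> w ` A = {}" 
  shows "(\<Sum>U\<in>Pow A. (-1) ^ card U * (if K \<subseteq> X - w ` U \<union> U then 1 else (0 :: real))) = 0"
proof -
  have finA: "finite A" using assms(2) by (metis card.infinite not_less_zero)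
  have "\<exists>a\<in>A. a \<notin> K \<and> w a \<notin> K"
  proof (rule ccontr)
    assume *: "\<not> ?thesis"
    define c where "c a = (if a \<in> K then a else w a)" for a
    have "c ` A \<subseteq> K" using * unfolding c_def by auto
    moreover have "inj_on c A"
    proof (rule inj_onI)
      fix x y assume "x \<in> A" "y \<in> A" "c x = c y"
      then show "x = y"
        using assms(3,4) unfolding c_def
        by (cases "x \<in> K"; cases "y \<in> K") (auto dest: inj_onD)
    qed
    ultimately have "card A \<le> card K" using assms(1) by (meson card_inj_on_le)
    then show False using assms(2) by simp
  qed
  then obtain a where a: "a \<in> A" "a \<notin> K" "w a \<notin> K" by blast
  show ?thesis
  proof (rule alternating_sum_eq_0_if_toggle_invariant[OF finA a(1)])
    fix U
    have "K \<subseteq> X - w ` insert a U \<union> insert a U \<longleftrightarrow> K \<subseteq> X - w ` U \<union> U" using a by auto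
    then show "(if K \<subseteq> X - w ` insert a U \<union> insert a U then 1 else 0)
        = (if K \<subseteq> X - w ` U \<union> U then 1 else (0 :: real))" by simp
  qed
qed

lemma card_keys_le_degree:
  "card (Poly_Mapping.keys u) \<le> (\<Sum>i\<in>Poly_Mapping.keys u. Poly_Mapping.lookup u i :: nat)"
proof -
  have "(\<Sum>i\<in>Poly_Mapping.keys u. 1) \<le> (\<Sum>i\<in>Poly_Mapping.keys u. Poly_Mapping.lookup u i)"
    by (intro sum_mono) (simp add: in_keys_iff Suc_le_eq)
  then show ?thesis by simp
qed

lemma has_degree_imp_swap_degree_le:
  assumes deg: "has_degree n k d f" and g: "\<And>X. X \<subseteq> {1..n} \<Longrightarrow> card X = k \<Longrightarrow> real_of_int (g X) = f (ind n X)"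
  shows "swap_degree_le {1..n} k d g"
  unfolding swap_degree_le_def
proof (intro allI impI, elim conjE)
  fix X A w
  assume X: "X \<subseteq> {1..n}" "card X = k" and A: "A \<subseteq> {1..n} - X" "d < card A"
    and w: "inj_on w A" "w ` A \<subseteq> X"
  obtain P where P: "in_vars {1..n} P" "total_degree_le d P"
      "\<And>x. x \<in> slice n k \<Longrightarrow> f x = mpoly_eval P (\<lambda>i. real (x i))"
    using deg unfolding has_degree_def by blast
  let ?c = "Poly_Mapping.lookup P"
  have "real_of_int (\<Sum>U\<in>Pow A. (-1) ^ card U * g (X - w ` U \<union> U))
      = (\<Sum>U\<in>Pow A. \<Sum>u\<in>Poly_Mapping.keys P.
           ?c u * ((-1) ^ card U * (if Poly_Mapping.keys u \<subseteq> X - w ` U \<union> U then 1 else 0)))"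
    unfolding of_int_sum
  proof (intro sum.cong refl)
    fix U assume U: "U \<in> Pow A"
    let ?Y = "X - w ` U \<union> U"
    have UA: "U \<subseteq> A" using U by simp
    have finX: "finite X" using X(1) finite_subset by blast
    have "A \<subseteq> {1..n}" using A(1) by blast
    then have finU: "finite U" using UA by (meson finite_atLeastAtMost finite_subset)
    have "U \<inter> X = {}" "w ` U \<subseteq> X" using UA A(1) w(2) by auto
    then have "card ?Y = k"
      using card_swap_set[OF finX finU _ inj_on_subset[OF w(1) UA]] X(2) by simp
    moreover have Y: "?Y \<subseteq> {1..n}" using X U A by auto
    ultimately have "real_of_int (g ?Y) = mpoly_eval P (\<lambda>i. real (ind n ?Y i))"
      using g P(3) ind_mem_slice by metis
    then show "real_of_int ((-1) ^ card U * g ?Y) = (\<Sum>u\<in>Poly_Mapping.keys P.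
           ?c u * ((-1) ^ card U * (if Poly_Mapping.keys u \<subseteq> ?Y then 1 else 0)))"
      by (simp add: mpoly_eval_ind[OF P(1)] sum_distrib_left mult.left_commute)
  qed
  also have "\<dots> = (\<Sum>u\<in>Poly_Mapping.keys P. ?c u * (\<Sum>U\<in>Pow A.
       (-1) ^ card U * (if Poly_Mapping.keys u \<subseteq> X - w ` U \<union> U then 1 else 0)))"
    by (subst sum.swap) (simp add: sum_distrib_left)
  also have "\<dots> = 0"
  proof (rule sum.neutral, rule ballI)
    fix u assume "u \<in> Poly_Mapping.keys P"
    then have "card (Poly_Mapping.keys u) \<le> d"
      using P(2) card_keys_le_degree[of u] unfolding total_degree_le_def by force
    moreover have "A \<inter> w ` A = {}" using A w by blast
    ultimately have "(\<Sum>U\<in>Pow A. (-1) ^ card U *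
        (if Poly_Mapping.keys u \<subseteq> X - w ` U \<union> U then 1 else (0 :: real))) = 0"
      using A(2) w(1) by (intro alternating_sum_small_monomial) auto
    then show "?c u * (\<Sum>U\<in>Pow A. (-1) ^ card U *
        (if Poly_Mapping.keys u \<subseteq> X - w ` U \<union> U then 1 else 0)) = 0" by simp
  qed
  finally show "(\<Sum>U\<in>Pow A. (-1) ^ card U * g (X - w ` U \<union> U)) = 0"
    by (simp only: of_int_eq_0_iff)
qed

text \<open>
  A value of the restriction to \<open>J\<close> is mapped to the value of \<open>f\<close> at an arbitrary point with that
  restriction.
\<close>

lemma junta_if_determined_on:
  assumes "J \<subseteq> {1..n}" "card J \<le> m"
    and det: "\<And>X Y. X \<subseteq> {1..n} \<Longrightarrow> card X = k \<Longrightarrow> Y \<subseteq> {1..n} \<Longrightarrow> card Y = k \<Longrightarrow> X \<inter> J = Y \<inter> J \<Longrightarrow>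
      f (ind n X) = f (ind n Y)"
  shows "junta n k m f"
proof -
  define h where "h y = f (SOME x. x \<in> slice n k \<and> restrict x J = y)" for y
  have "f x = h (restrict x J)" if x: "x \<in> slice n k" for x
  proof -
    define x' where "x' = (SOME z. z \<in> slice n k \<and> restrict z J = restrict x J)"
    have x': "x' \<in> slice n k" "restrict x' J = restrict x J"
      using someI[of "\<lambda>z. z \<in> slice n k \<and> restrict z J = restrict x J" x] x unfolding x'_def by auto
    obtain X where X: "X \<subseteq> {1..n}" "card X = k" "x = ind n X" using x unfolding slice_eq_image_ind by blast
    obtain Y where Y: "Y \<subseteq> {1..n}" "card Y = k" "x' = ind n Y" using x' unfolding slice_eq_image_ind by blast
    have "i \<in> X \<longleftrightarrow> i \<in> Y" if i: "i \<in> J" for i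
    proof -
      have "i \<in> {1..n}" using i assms(1) by blast
      then have "ind n Z i = (if i \<in> Z then 1 else 0)" for Z by (simp add: ind_def)
      moreover have "restrict x' J i = restrict x J i" by (simp only: x'(2))
      then have "ind n Y i = ind n X i" by (simp only: restrict_apply' i X(3) Y(3))
      ultimately show ?thesis by (metis zero_neq_one)
    qed
    then have "X \<inter> J = Y \<inter> J" by auto
    then have "f (ind n X) = f (ind n Y)" by (rule det[OF X(1,2) Y(1,2)])
    then show ?thesis unfolding h_def x'_def[symmetric] by (simp only: X(3) Y(3))
  qed
  then have "set_junta n k J f" unfolding set_junta_def by (intro exI[of _ h]) blast
  then show ?thesis unfolding junta_def using assms(1,2) by blast
qed

section \<open>Weights below twice the degree\<close>

definition squarefree_monomial :: "nat set \<Rightarrow> nat \<Rightarrow>\<^sub>0 nat" where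
  "squarefree_monomial B = (\<Sum>i\<in>B. Poly_Mapping.single i 1)"

definition monomial_sum :: "nat set set \<Rightarrow> real_mpoly" where
  "monomial_sum \<B> = (\<Sum>B\<in>\<B>. Poly_Mapping.single (squarefree_monomial B) 1)"

lemma lookup_squarefree_monomial:
  "finite B \<Longrightarrow> Poly_Mapping.lookup (squarefree_monomial B) i = (if i \<in> B then 1 else 0)"
  unfolding squarefree_monomial_def by (simp add: lookup_sum lookup_single when_def)

lemma keys_squarefree_monomial: "finite B \<Longrightarrow> Poly_Mapping.keys (squarefree_monomial B) = B"
  by (auto simp: in_keys_iff lookup_squarefree_monomial split: if_splits)

lemma lookup_monomial_sum:
  assumes "finite \<B>" "\<forall>B\<in>\<B>. finite B"
  shows "Poly_Mapping.lookup (monomial_sum \<B>) u = (if u \<in> squarefree_monomial ` \<B> then 1 else 0)"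
proof -
  have inj: "inj_on squarefree_monomial \<B>"
    using assms(2) keys_squarefree_monomial by (metis inj_on_def)
  have "Poly_Mapping.lookup (monomial_sum \<B>) u = (\<Sum>B\<in>\<B>. if squarefree_monomial B = u then 1 else 0)"
    unfolding monomial_sum_def by (simp add: lookup_sum lookup_single when_def)
  also have "\<dots> = (\<Sum>v\<in>squarefree_monomial ` \<B>. if v = u then 1 else 0)"
    using inj by (simp add: sum.reindex)
  also have "\<dots> = (if u \<in> squarefree_monomial ` \<B> then 1 else 0)"
    using assms(1) by simp
  finally show ?thesis .
qed

lemma monomial_sum_on_slice:
  assumes fin: "finite \<B>" and B: "\<And>B. B \<in> \<B> \<Longrightarrow> B \<subseteq> {1..n}" "\<And>B. B \<in> \<B> \<Longrightarrow> card B \<le> d"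
  shows "in_vars {1..n} (monomial_sum \<B>)" "total_degree_le d (monomial_sum \<B>)"
    "mpoly_eval (monomial_sum \<B>) (\<lambda>i. real (ind n X i)) = real (card {B \<in> \<B>. B \<subseteq> X})"
proof -
  have finB: "\<forall>B\<in>\<B>. finite B" using B(1) finite_subset by blast
  have keys: "Poly_Mapping.keys (monomial_sum \<B>) = squarefree_monomial ` \<B>"
    by (auto simp: in_keys_iff lookup_monomial_sum[OF fin finB] split: if_splits)
  have inj: "inj_on squarefree_monomial \<B>"
    using finB keys_squarefree_monomial by (metis inj_on_def)
  show vars: "in_vars {1..n} (monomial_sum \<B>)"
    unfolding in_vars_def keys using B(1) finB keys_squarefree_monomial by auto
  show "total_degree_le d (monomial_sum \<B>)"
    unfolding total_degree_le_def keys
  proof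
    fix u assume "u \<in> squarefree_monomial ` \<B>"
    then obtain B where "B \<in> \<B>" "u = squarefree_monomial B" by blast
    then show "(\<Sum>i\<in>Poly_Mapping.keys u. Poly_Mapping.lookup u i) \<le> d"
      using finB assms(3) by (simp add: keys_squarefree_monomial lookup_squarefree_monomial)
  qed
  show "mpoly_eval (monomial_sum \<B>) (\<lambda>i. real (ind n X i)) = real (card {B \<in> \<B>. B \<subseteq> X})"
  proof -
    have "mpoly_eval (monomial_sum \<B>) (\<lambda>i. real (ind n X i))
        = (\<Sum>u\<in>squarefree_monomial ` \<B>. if Poly_Mapping.keys u \<subseteq> X then 1 else 0)"
      unfolding mpoly_eval_ind[OF vars] keys
      by (intro sum.cong refl) (simp add: lookup_monomial_sum[OF fin finB])
    also have "\<dots> = (\<Sum>B\<in>\<B>. if Poly_Mapping.keys (squarefree_monomial B) \<subseteq> X then 1 else 0)"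
      using inj by (simp add: sum.reindex)
    also have "\<dots> = (\<Sum>B\<in>\<B>. if B \<subseteq> X then 1 else 0)"
      using finB keys_squarefree_monomial by (intro sum.cong) auto
    also have "\<dots> = real (card {B \<in> \<B>. B \<subseteq> X})"
      using fin by (simp add: sum.If_cases Int_def)
    finally show ?thesis .
  qed
qed

text \<open>
  The blocks have size \<open>e = min d k\<close>, so that their monomials have degree at most \<open>d\<close>, a block
  fits into a set of size \<open>k\<close>, and two disjoint blocks do not, as \<open>k < 2 * e\<close>.
  Among \<open>m + 1\<close> blocks one avoids \<open>J\<close>, and there remain \<open>k\<close> coordinates outside all blocks and
  outside \<open>J\<close>. With them one builds two points that vanish on \<open>J\<close>, of which exactly one contains
  a block.
\<close>

lemma ex_nonjunta_below_threshold:
  assumes "d \<ge> 1" "1 \<le> k" "k < 2 * d"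
  shows "\<exists>n \<ge> 2 * k. \<exists>f. boolean_on_slice n k f \<and> has_degree n k d f \<and> \<not> junta n k m f"
proof -
  define e where "e = min d k"
  have e: "1 \<le> e" "e \<le> k" "e \<le> d" "k < 2 * e" unfolding e_def using assms by auto
  define N where "N = Suc m"
  define n where "n = N * e + m + 2 * k"
  define blk where "blk j = {j * e + 1..j * e + e}" for j
  have card_blk: "card (blk j) = e" for j unfolding blk_def by simp
  have blk_low: "blk j \<subseteq> {1..N * e}" if "j < N" for j
  proof -
    have "Suc j * e \<le> N * e" using that by (intro mult_right_mono) auto
    then show ?thesis unfolding blk_def by auto
  qed
  have blk_disj: "blk i \<inter> blk j = {}" if "i \<noteq> j" for i j
  proof -
    have "blk a \<inter> blk b = {}" if "a < b" for a b
    proof -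
      have "Suc a * e \<le> b * e" using that by (intro mult_right_mono) auto
      then show ?thesis unfolding blk_def by auto
    qed
    then show ?thesis using \<open>i \<noteq> j\<close> by (metis Int_commute linorder_neqE_nat)
  qed
  define \<B> where "\<B> = blk ` {..<N}"
  define f where "f x = mpoly_eval (monomial_sum \<B>) (\<lambda>i. real (x i))" for x :: "nat \<Rightarrow> nat"
  have fin: "finite \<B>" unfolding \<B>_def by simp
  have sub: "B \<subseteq> {1..n}" if "B \<in> \<B>" for B
    using that blk_low unfolding \<B>_def n_def by fastforce
  have cd: "card B \<le> d" if "B \<in> \<B>" for B
    using that card_blk e unfolding \<B>_def by auto
  note ms = monomial_sum_on_slice[OF fin sub cd]
  have f_ind: "f (ind n X) = real (card {B \<in> \<B>. B \<subseteq> X})" for X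
    unfolding f_def using ms(3) by simp
  have "has_degree n k d f" unfolding has_degree_def f_def using ms(1,2) by blast
  moreover have "boolean_on_slice n k f"
    unfolding boolean_on_slice_def
  proof
    fix x assume "x \<in> slice n k"
    then obtain X where X: "X \<subseteq> {1..n}" "card X = k" "x = ind n X"
      unfolding slice_eq_image_ind by blast
    have finX: "finite X" using X finite_subset by blast
    have "card {B \<in> \<B>. B \<subseteq> X} \<le> 1"
    proof (rule ccontr)
      assume "\<not> ?thesis"
      then obtain B C where BC: "B \<in> \<B>" "C \<in> \<B>" "B \<subseteq> X" "C \<subseteq> X" "B \<noteq> C"
        using fin card_le_Suc0_iff_eq[of "{B \<in> \<B>. B \<subseteq> X}"] by auto
      then obtain i j where ij: "B = blk i" "C = blk j" "i \<noteq> j" unfolding \<B>_def by auto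
      have "2 * e = card (B \<union> C)"
        using ij card_blk blk_disj[OF ij(3)] by (subst card_Un_disjoint) (auto simp: blk_def)
      also have "\<dots> \<le> card X" using BC finX by (intro card_mono) auto
      finally show False using X(2) e(4) by simp
    qed
    then have "card {B \<in> \<B>. B \<subseteq> X} = 0 \<or> card {B \<in> \<B>. B \<subseteq> X} = 1" by linarith
    then show "f x \<in> {0, 1}" unfolding X(3) f_ind by auto
  qed
  moreover have "\<not> junta n k m f"
  proof
    assume "junta n k m f"
    then obtain J h where J: "J \<subseteq> {1..n}" "card J \<le> m"
        and h: "\<And>x. x \<in> slice n k \<Longrightarrow> f x = h (restrict x J)"
      unfolding junta_def set_junta_def by blast
    have finJ: "finite J" using J finite_subset by blast
    have "\<exists>j<N. blk j \<inter> J = {}"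
    proof (rule ccontr)
      assume "\<not> ?thesis"
      then have "\<forall>j\<in>{..<N}. \<exists>i. i \<in> blk j \<inter> J" by blast
      then obtain c where c: "\<And>j. j < N \<Longrightarrow> c j \<in> blk j \<inter> J" by (metis lessThan_iff)
      have "inj_on c {..<N}"
      proof (rule inj_onI)
        fix i j assume "i \<in> {..<N}" "j \<in> {..<N}" "c i = c j"
        then have "c i \<in> blk i \<inter> blk j" using c[of i] c[of j] by simp
        then show "i = j" using blk_disj by blast
      qed
      then have "N \<le> card J" using card_inj_on_le[of c "{..<N}" J] c finJ by auto
      then show False using J unfolding N_def by simp
    qed
    then obtain j where j: "j < N" "blk j \<inter> J = {}" by blast
    define Free where "Free = {N * e + 1..n} - J"
    have "card {N * e + 1..n} - card J \<le> card Free"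
      unfolding Free_def by (rule diff_card_le_card_Diff[OF finJ])
    then have "k \<le> card Free" using J(2) unfolding n_def by simp
    then obtain Y where Y: "Y \<subseteq> Free" "card Y = k" "finite Y"
      by (meson obtain_subset_with_card_n)
    have "k - e \<le> card Y" using Y by simp
    then obtain Z where Z: "Z \<subseteq> Y" "card Z = k - e" "finite Z"
      by (meson obtain_subset_with_card_n)
    define X where "X = blk j \<union> Z"
    have disj: "blk i \<inter> Free = {}" if "i < N" for i
      using blk_low[OF that] unfolding Free_def by auto
    have "blk j \<inter> Z = {}" using disj[OF j(1)] Y Z by blast
    then have "card X = k"
      unfolding X_def using card_blk e Z by (subst card_Un_disjoint) (auto simp: blk_def)
    moreover have "X \<subseteq> {1..n}" "Y \<subseteq> {1..n}"
      using blk_low[OF j(1)] Y Z unfolding X_def Free_def n_def by fastforce+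
    ultimately have mem: "ind n X \<in> slice n k" "ind n Y \<in> slice n k"
      using ind_mem_slice Y by auto
    have "X \<inter> J = {}" "Y \<inter> J = {}" using j Y Z unfolding X_def Free_def by auto
    then have "restrict (ind n X) J = restrict (ind n Y) J"
      using J(1) by (intro restrict_ext) (auto simp: ind_def)
    then have "f (ind n X) = f (ind n Y)" using h mem by metis
    moreover have "{B \<in> \<B>. B \<subseteq> Y} = {}"
    proof -
      have "\<not> blk i \<subseteq> Y" if "i < N" for i
        using disj[OF that] Y card_blk[of i] e(1) by (metis Int_absorb2 Int_commute card.empty not_one_le_zero subset_trans)
      then show ?thesis unfolding \<B>_def by auto
    qed
    moreover have "blk j \<in> {B \<in> \<B>. B \<subseteq> X}" unfolding \<B>_def X_def using j by auto
    then have "card {B \<in> \<B>. B \<subseteq> X} \<noteq> 0" using fin by auto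
    ultimately show False unfolding f_ind by simp
  qed
  moreover have "n \<ge> 2 * k" unfolding n_def by simp
  ultimately show ?thesis by blast
qed

section \<open>The threshold\<close>

theorem theorem1p1:
  fixes d :: nat
  assumes "d \<ge> 1"
  shows "(\<exists>m::nat. \<forall>k n :: nat. k \<ge> 2 * d \<longrightarrow> n \<ge> 2 * k \<longrightarrow>
            (\<forall>f. boolean_on_slice n k f \<and> has_degree n k d f \<longrightarrow> junta n k m f))
       \<and> (\<forall>k::nat. 1 \<le> k \<and> k < 2 * d \<longrightarrow>
            (\<forall>m::nat. \<exists>n \<ge> 2 * k. \<exists>f.
               boolean_on_slice n k f \<and> has_degree n k d f \<and> \<not> junta n k m f))"
proof (intro conjI allI impI; (elim conjE)?)
  obtain m where m: "\<And>(V :: nat set) k g. finite V \<Longrightarrow> 2 * d \<le> k \<Longrightarrow> 2 * k \<le> card V \<Longrightarrow>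
     range g \<subseteq> {0, 1} \<Longrightarrow> swap_degree_le V k d g \<Longrightarrow>
     \<exists>J \<subseteq> V. card J \<le> m \<and>
       (\<forall>X Y. X \<subseteq> V \<and> card X = k \<and> Y \<subseteq> V \<and> card Y = k \<and> X \<inter> J = Y \<inter> J \<longrightarrow> g X = g Y)"
    using junta_bound[OF assms, where 'a = nat] by metis
  have "junta n k m f"
    if k: "2 * d \<le> k" "2 * k \<le> n" and f: "boolean_on_slice n k f" "has_degree n k d f" for k n f
  proof -
    define g :: "nat set \<Rightarrow> int" where "g X = (if f (ind n X) = 1 then 1 else 0)" for X
    have g_f: "real_of_int (g X) = f (ind n X)" if "X \<subseteq> {1..n}" "card X = k" for X
      using f(1) ind_mem_slice[OF that] unfolding boolean_on_slice_def g_def by auto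
    have "range g \<subseteq> {0, 1}" unfolding g_def by auto
    moreover have "swap_degree_le {1..n} k d g"
      by (rule has_degree_imp_swap_degree_le[OF f(2) g_f])
    ultimately obtain J where J: "J \<subseteq> {1..n}" "card J \<le> m"
      and det: "\<forall>X Y. X \<subseteq> {1..n} \<and> card X = k \<and> Y \<subseteq> {1..n} \<and> card Y = k \<and> X \<inter> J = Y \<inter> J \<longrightarrow> g X = g Y"
      using m[of "{1..n}" k g] k by auto
    show ?thesis
    proof (rule junta_if_determined_on[OF J])
      fix X Y assume XY: "X \<subseteq> {1..n}" "card X = k" "Y \<subseteq> {1..n}" "card Y = k" "X \<inter> J = Y \<inter> J"
      then have "g X = g Y" using det by blast
      then show "f (ind n X) = f (ind n Y)" using g_f XY by metis
    qed
  qed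
  then show "\<exists>m. \<forall>k n. 2 * d \<le> k \<longrightarrow> 2 * k \<le> n \<longrightarrow>
      (\<forall>f. boolean_on_slice n k f \<and> has_degree n k d f \<longrightarrow> junta n k m f)"
    by blast
next
  fix k m :: nat assume "1 \<le> k" "k < 2 * d"
  then show "\<exists>n \<ge> 2 * k. \<exists>f. boolean_on_slice n k f \<and> has_degree n k d f \<and> \<not> junta n k m f"
    by (rule ex_nonjunta_below_threshold[OF assms])
qed

end
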